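(* Let $\Omega = \{27,39,43,55,79,87,91,99,103,111,127,135,151,159,175\}$. For each $w \in \Omega$, there exists a Steiner triple system $\mathrm{STS}(w)$ (obtained by a doubling construction from an $\mathrm{STS}((w-1)/2)$) that admits an extended bicoloring, and consequently for each $w\in\Omega$ there exists an $\mathrm{STS}(w)$ with $\chi \neq \bar\chi$, where $\chi$ and $\bar\chi$ denote its lower and upper chromatic numbers.
   Context: A Steiner triple system of order $v$, $\mathrm{STS}(v)$, is a pair $(V,\mathcal B)$ with $|V|=v$ and $\mathcal B$ a collection of $3$-subsets of $V$ (triples) such that every $2$-subset of $V$ lies in exactly one triple. A (strict) $k$-bicoloring of $(V,\mathcal B)$ is a map from $V$ onto a set of exactly $k$ colors such that every triple receives exactly two distinct colors. The lower chromatic number $\chi$ (upper chromatic number $\bar\chi$) of a bicolorable STS is the minimum (maximum) $k$ for which it has a strict $k$-bicoloring. Doubling construction: let $(V,\mathcal B)$ be an $\mathrm{STS}(v)$ with $V=\{a_1,\dots,a_v\}$, let $Y$ be a set with $|Y|=v+1$ disjoint from $V$, and let $F_1,\dots,F_v$ be a $1$-factorization of the complete graph on $Y$. Then $(V\cup Y,\ \mathcal B\cup\{\{a_i,x,y\}: 1\le i\le v,\ \{x,y\}\in F_i\})$ is an $\mathrm{STS}(2v+1)$, said to be obtained from $(V,\mathcal B)$ by a doubling construction. Extended bicoloring: if $C$ is a strict $k$-bicoloring of an $\mathrm{STS}(v)$ $(V,\mathcal B)$ and $S'$ is an $\mathrm{STS}(2v+1)$ on $V\cup Y$ obtained from $(V,\mathcal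 B)$ by a doubling construction, an extended ($k$-)bicoloring of $C$ is a $k$-bicoloring of $S'$ whose restriction to $V$ is $C$ and in which the elements of $Y$ are colored using only the $k$ colors of $C$. *)

theory Defs
  imports "HOL-Library.Disjoint_Sets"
begin

definition steiner_triple_system :: "nat \<Rightarrow> 'a set \<Rightarrow> 'a set set \<Rightarrow> bool" where
  "steiner_triple_system v V B \<longleftrightarrow>
     finite V \<and> card V = v \<and>
     (\<forall>T\<in>B. T \<subseteq> V \<and> card T = 3) \<and>
     (\<forall>P. P \<subseteq> V \<and> card P = 2 \<longrightarrow> (\<exists>!T. T \<in> B \<and> P \<subseteq> T))"

text \<open>
  Colorings are total functions of which only the values on the point set matter; "onto a set of
  exactly k colors" says that the image of the point set has k elements.
\<close>
definition strict_bicoloring :: "nat \<Rightarrow> 'a set \<Rightarrow> 'a set set \<Rightarrow> ('a \<Rightarrow> 'c) \<Rightarrow> bool" where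
  "strict_bicoloring k V B c \<longleftrightarrow> card (c ` V) = k \<and> (\<forall>T\<in>B. card (c ` T) = 2)"

text \<open>Natural numbers suffice as colors, since the point sets considered are finite.\<close>
definition bicolorable_with :: "'a set \<Rightarrow> 'a set set \<Rightarrow> nat \<Rightarrow> bool" where
  "bicolorable_with V B k \<longleftrightarrow> (\<exists>c :: 'a \<Rightarrow> nat. strict_bicoloring k V B c)"

definition bicolorable :: "'a set \<Rightarrow> 'a set set \<Rightarrow> bool" where
  "bicolorable V B \<longleftrightarrow> (\<exists>k. bicolorable_with V B k)"

text \<open>
  These two numbers are meaningful only for bicolorable systems on a finite point set; there
  \<open>k \<le> card V\<close> for every strict k-bicoloring, so the maximum exists.
\<close>
definition lower_chromatic_number :: "'a set \<Rightarrow> 'a set set \<Rightarrow> nat" where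
  "lower_chromatic_number V B = (LEAST k. bicolorable_with V B k)"

definition upper_chromatic_number :: "'a set \<Rightarrow> 'a set set \<Rightarrow> nat" where
  "upper_chromatic_number V B = (GREATEST k. bicolorable_with V B k)"

definition complete_graph_edges :: "'a set \<Rightarrow> 'a set set" where
  "complete_graph_edges Y = {e. e \<subseteq> Y \<and> card e = 2}"

definition one_factor :: "'a set \<Rightarrow> 'a set set \<Rightarrow> bool" where
  "one_factor Y M \<longleftrightarrow> M \<subseteq> complete_graph_edges Y \<and> (\<forall>y\<in>Y. \<exists>!e. e \<in> M \<and> y \<in> e)"

definition one_factorization :: "'a set \<Rightarrow> 'i set \<Rightarrow> ('i \<Rightarrow> 'a set set) \<Rightarrow> bool" where
  "one_factorization Y I F \<longleftrightarrow>
     (\<forall>i\<in>I. one_factor Y (F i)) \<and>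
     disjoint_family_on F I \<and>
     (\<Union>i\<in>I. F i) = complete_graph_edges Y"

text \<open>
  The factors are indexed by the points of \<open>V\<close> themselves: \<open>F a\<close> is the factor that goes with the
  point \<open>a\<close>, so no enumeration of \<open>V\<close> is needed. The point set of the new system is \<open>V \<union> Y\<close>.
\<close>
definition doubling_construction ::
    "'a set \<Rightarrow> 'a set set \<Rightarrow> 'a set \<Rightarrow> 'a set set \<Rightarrow> bool" where
  "doubling_construction V B Y B' \<longleftrightarrow>
     finite Y \<and> card Y = card V + 1 \<and> V \<inter> Y = {} \<and>
     (\<exists>F. one_factorization Y V F \<and>
          B' = B \<union> {{a, x, y} | a x y. a \<in> V \<and> {x, y} \<in> F a})"

definition extended_bicoloring ::
    "nat \<Rightarrow> 'a set \<Rightarrow> 'a set set \<Rightarrow> ('a \<Rightarrow> 'c) \<Rightarrow> 'a set \<Rightarrow> 'a set set \<Rightarrow> ('a \<Rightarrow> 'c) \<Rightarrow> bool" where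
  "extended_bicoloring k V B C Y B' C' \<longleftrightarrow>
     strict_bicoloring k V B C \<and>
     strict_bicoloring k (V \<union> Y) B' C' \<and>
     (\<forall>x\<in>V. C' x = C x) \<and>
     C' ` Y \<subseteq> C ` V"

end

theory Submission
  imports Defs "HOL-Library.Code_Binary_Nat" "HOL-Number_Theory.Cong"
begin

text \<open>
  In a doubling, the triples through the new points amount to an edge colouring of the complete graph
  on \<open>Y\<close> by the points of \<open>V\<close>. Giving all of \<open>Y\<close> one new colour always extends a \<open>k\<close>-bicoloring to a
  \<open>(k + 1)\<close>-bicoloring of the doubled system, so an extended \<open>k\<close>-bicoloring forces the two chromatic
  numbers apart.

  For \<open>v \<equiv> 3 (mod 4)\<close>, an extended bicoloring exists as soon as two colour classes together have
  \<open>(v + 1) / 2\<close> points. This property passes from \<open>v\<close> to \<open>2v + 1\<close> by the standard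
  doubling, which leaves only a few small systems to be given explicitly. The orders \<open>v \<equiv> 1 (mod 4)\<close>
  use explicit edge colourings.
\<close>

section \<open>Steiner triple systems and doubling\<close>

text \<open>Each triple of a bicolored system contains exactly one monochromatic pair, so class
  sizes n_i satisfy: the sum of n_i (n_i - 1) / 2 equals v (v - 1) / 6. The class sizes in all
  tables, and those of the extended colourings, solve this equation. Split Y into two equal parts of
  size m = (v + 1) / 2, coloured by two old colours whose classes have s points together. Counting
  monochromatic pairs in the v m new triples gives m (m - 1) + m s = v m, hence s = m. So the
  halving condition is forced. The residue of v enters because an old point of a third colour cannot
  lie on an edge between the parts. It must match each part within itself, so m has to be even.
  Doubling an odd v always lands in the class 3 (mod 4), which is why seeds of order 1 (mod 4)
  become usable after one step. If an order 1 (mod 4) has to be extended itself, equal parts would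
  be odd, and the tables colour Y with three or four colours instead.\<close>

lemma steiner_third_point:
  assumes "steiner_triple_system v V B" "x \<in> V" "y \<in> V" "x \<noteq> y"
  obtains z where "z \<in> V" "z \<noteq> x" "z \<noteq> y" "{x, y, z} \<in> B"
proof -
  have "{x, y} \<subseteq> V \<and> card {x, y} = 2"
    using assms by auto
  then obtain T where T: "T \<in> B" "{x, y} \<subseteq> T"
    using assms(1) unfolding steiner_triple_system_def by metis
  then have "T \<subseteq> V" "card T = 3"
    using assms(1) unfolding steiner_triple_system_def by auto
  then obtain a b c where "T = {a, b, c}" "a \<noteq> b" "a \<noteq> c" "b \<noteq> c"
    by (auto simp: card_3_iff)
  then have "\<exists>z\<in>T. z \<noteq> x \<and> z \<noteq> y \<and> T = {x, y, z}"
    using T(2) assms(4) by auto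
  then show thesis
    using that T(1) \<open>T \<subseteq> V\<close> by blast
qed

lemma steiner_block_eq:
  assumes "steiner_triple_system v V B" "S \<in> B" "T \<in> B" "x \<noteq> y" "{x, y} \<subseteq> S" "{x, y} \<subseteq> T"
  shows "S = T"
proof -
  have "{x, y} \<subseteq> V \<and> card {x, y} = 2"
    using assms unfolding steiner_triple_system_def by auto
  then have "\<exists>!T. T \<in> B \<and> {x, y} \<subseteq> T"
    using assms(1) unfolding steiner_triple_system_def by metis
  then show ?thesis
    using assms(2,3,5,6) by blast
qed

text \<open>A pair has three possible positions. Inside V it keeps its old triple, since a new
  triple has only one point in V. Across V and Y, the point of Y lies on exactly one edge of the
  factor of the point of V. Inside Y, the pair is an edge and lies in exactly one factor.\<close>

lemma doubling_construction_steiner: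
  assumes S: "steiner_triple_system v V B" and D: "doubling_construction V B Y B'"
  shows "steiner_triple_system (2 * v + 1) (V \<union> Y) B'"
proof -
  have fin: "finite V" "card V = v" "finite Y" "card Y = v + 1" and disj: "V \<inter> Y = {}"
    and BV: "\<And>T. T \<in> B \<Longrightarrow> T \<subseteq> V \<and> card T = 3"
    using S D unfolding steiner_triple_system_def doubling_construction_def by auto
  obtain F where F: "one_factorization Y V F"
    and B': "B' = B \<union> {{a, x, y} | a x y. a \<in> V \<and> {x, y} \<in> F a}"
    using D unfolding doubling_construction_def by blast
  have factor: "one_factor Y (F a)" if "a \<in> V" for a
    using F that unfolding one_factorization_def by simp
  have edge: "e \<subseteq> Y \<and> card e = 2" if "a \<in> V" "e \<in> F a" for a e
    using factor[OF that(1)] that(2) unfolding one_factor_def complete_graph_edges_def by auto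
  have B'_iff: "T \<in> B' \<longleftrightarrow> T \<in> B \<or> (\<exists>a\<in>V. \<exists>e\<in>F a. T = insert a e)" for T
  proof -
    have "T \<in> B' \<longleftrightarrow> T \<in> B \<or> (\<exists>a x y. T = {a, x, y} \<and> a \<in> V \<and> {x, y} \<in> F a)"
      unfolding B' by blast
    moreover have "\<exists>x y. e = {x, y}" if "a \<in> V" "e \<in> F a" for a e
      using edge[OF that] by (auto simp: card_2_iff)
    ultimately show ?thesis
      by (metis insert_iff)
  qed
  have "T \<subseteq> V \<union> Y \<and> card T = 3" if T: "T \<in> B'" for T
  proof (cases "T \<in> B")
    case True
    then show ?thesis
      using BV[OF True] by auto
  next
    case False
    then obtain a e where ae: "a \<in> V" "e \<in> F a" "T = insert a e"
      using False T B'_iff by blast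
    moreover have "a \<notin> e" "finite e"
      using edge[OF ae(1,2)] ae(1) disj fin(3) finite_subset by blast+
    ultimately have "card T = 3"
      using edge[OF ae(1,2)] by simp
    moreover have "T \<subseteq> V \<union> Y"
      using edge[OF ae(1,2)] ae by blast
    ultimately show ?thesis
      by blast
  qed
  moreover have "\<exists>!T. T \<in> B' \<and> P \<subseteq> T" if P: "P \<subseteq> V \<union> Y \<and> card P = 2" for P
  proof -
    obtain p q where pq: "P = {p, q}" "p \<noteq> q"
      using P by (auto simp: card_2_iff)
    have ex1: "\<exists>!T. T \<in> B' \<and> {p, q} \<subseteq> T" if "p \<in> V" "q \<in> V" "p \<noteq> q" for p q
    proof -
      have "\<not> {p, q} \<subseteq> insert a e" if "a \<in> V" "e \<in> F a" for a e
        using edge[OF that] \<open>p \<in> V\<close> \<open>q \<in> V\<close> \<open>p \<noteq> q\<close> disj by blast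
      moreover have "{p, q} \<subseteq> V \<and> card {p, q} = 2"
        using that by auto
      then have "\<exists>!T. T \<in> B \<and> {p, q} \<subseteq> T"
        using S unfolding steiner_triple_system_def by metis
      ultimately show ?thesis
        using B'_iff by metis
    qed
    have ex2: "\<exists>!T. T \<in> B' \<and> {p, q} \<subseteq> T" if "p \<in> V" "q \<in> Y" for p q
    proof -
      have old: "q \<notin> T" if "T \<in> B" for T
        using BV[OF that] disj \<open>q \<in> Y\<close> by blast
      have iff: "T \<in> B' \<and> {p, q} \<subseteq> T \<longleftrightarrow> (\<exists>e\<in>F p. q \<in> e \<and> T = insert p e)" for T
      proof (intro iffI)
        assume T: "T \<in> B' \<and> {p, q} \<subseteq> T"
        then obtain a e where ae: "a \<in> V" "e \<in> F a" "T = insert a e"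
          using B'_iff[of T] old[of T] by blast
        have "p \<notin> e" "q \<noteq> a"
          using edge[OF ae(1,2)] ae(1) disj \<open>p \<in> V\<close> \<open>q \<in> Y\<close> by blast+
        then show "\<exists>e\<in>F p. q \<in> e \<and> T = insert p e"
          using T ae by blast
      next
        assume "\<exists>e\<in>F p. q \<in> e \<and> T = insert p e"
        then show "T \<in> B' \<and> {p, q} \<subseteq> T"
          using B'_iff[of T] \<open>p \<in> V\<close> by blast
      qed
      have "\<exists>!e. e \<in> F p \<and> q \<in> e"
        using factor[OF \<open>p \<in> V\<close>] \<open>q \<in> Y\<close> unfolding one_factor_def by simp
      then show ?thesis
        unfolding iff by blast
    qed
    have ex3: "\<exists>!T. T \<in> B' \<and> {p, q} \<subseteq> T" if "p \<in> Y" "q \<in> Y" "p \<noteq> q" for p q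
    proof -
      have old: "q \<notin> T" if "T \<in> B" for T
        using BV[OF that] disj \<open>q \<in> Y\<close> by blast
      have new: "e = {p, q}" if "a \<in> V" "e \<in> F a" "{p, q} \<subseteq> insert a e" for a e
      proof -
        have "{p, q} \<subseteq> e"
          using that disj \<open>p \<in> Y\<close> \<open>q \<in> Y\<close> by blast
        then show ?thesis
          using edge[OF that(1,2)] \<open>p \<noteq> q\<close> by (auto simp: card_2_iff)
      qed
      have iff: "T \<in> B' \<and> {p, q} \<subseteq> T \<longleftrightarrow> (\<exists>a\<in>V. {p, q} \<in> F a \<and> T = {a, p, q})" for T
      proof (intro iffI)
        assume T: "T \<in> B' \<and> {p, q} \<subseteq> T"
        then obtain a e where "a \<in> V" "e \<in> F a" "T = insert a e"
          using B'_iff[of T] old[of T] by blast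
        then show "\<exists>a\<in>V. {p, q} \<in> F a \<and> T = {a, p, q}"
          using new[of a e] T by auto
      next
        assume "\<exists>a\<in>V. {p, q} \<in> F a \<and> T = {a, p, q}"
        then show "T \<in> B' \<and> {p, q} \<subseteq> T"
          using B'_iff[of T] by auto
      qed
      have "{p, q} \<in> complete_graph_edges Y"
        using that unfolding complete_graph_edges_def by auto
      then obtain a where "a \<in> V" "{p, q} \<in> F a"
        using F unfolding one_factorization_def by auto
      moreover have "b = a" if "b \<in> V" "{p, q} \<in> F b" for b
        using F that calculation unfolding one_factorization_def disjoint_family_on_def by auto
      ultimately show ?thesis
        unfolding iff by blast
    qed
    show ?thesis
      using pq P ex1[of p q] ex2[of p q] ex2[of q p] ex3[of p q]
      by (auto simp: insert_commute)
  qed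
  moreover have "finite (V \<union> Y)" "card (V \<union> Y) = 2 * v + 1"
    using fin disj by (auto simp: card_Un_disjoint)
  ultimately show ?thesis
    unfolding steiner_triple_system_def by blast
qed

section \<open>Doubling along a proper edge colouring\<close>

text \<open>A one-factorization of a complete graph as a function that names the factor of each
  edge. For n = v + 1 the n - 1 colours are the points of a system of order v. Diagonal values are
  left free.\<close>

definition proper_edge_colouring :: "nat \<Rightarrow> (nat \<Rightarrow> nat \<Rightarrow> nat) \<Rightarrow> bool" where
  "proper_edge_colouring n f \<longleftrightarrow>
     (\<forall>x<n. \<forall>y<n. x \<noteq> y \<longrightarrow> f x y < n - 1 \<and> f y x = f x y) \<and>
     (\<forall>x<n. inj_on (f x) ({..<n} - {x}))"

text \<open>Pigeonhole: the n - 1 edges at \<open>x\<close> have distinct colours out of n - 1, so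
  every colour occurs there.\<close>

lemma proper_edge_colouring_ex1:
  assumes f: "proper_edge_colouring n f" and "x < n" "a < n - 1"
  shows "\<exists>!y. y < n \<and> y \<noteq> x \<and> f x y = a"
proof -
  have inj: "inj_on (f x) ({..<n} - {x})"
    using f \<open>x < n\<close> unfolding proper_edge_colouring_def by blast
  have "f x ` ({..<n} - {x}) = {..<n - 1}"
  proof (rule card_subset_eq)
    show "f x ` ({..<n} - {x}) \<subseteq> {..<n - 1}"
      using f \<open>x < n\<close> unfolding proper_edge_colouring_def by auto
    show "card (f x ` ({..<n} - {x})) = card {..<n - 1}"
      using inj \<open>x < n\<close> by (simp add: card_image)
  qed simp
  then have "a \<in> f x ` ({..<n} - {x})"
    using \<open>a < n - 1\<close> by simp
  then obtain y where "y < n" "y \<noteq> x" "f x y = a"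
    by auto
  then show ?thesis
    using inj unfolding inj_on_def by blast
qed

text \<open>The shift by \<open>v\<close> moves the new points behind the old ones, so that the
  doubled system again occupies an initial segment of the naturals and can itself be
  doubled.\<close>

definition factor :: "nat \<Rightarrow> (nat \<Rightarrow> nat \<Rightarrow> nat) \<Rightarrow> nat \<Rightarrow> nat set set" where
  "factor v f a = {{v + x, v + y} | x y. x < v + 1 \<and> y < v + 1 \<and> x \<noteq> y \<and> f x y = a}"

definition doubled_blocks :: "nat \<Rightarrow> nat set set \<Rightarrow> (nat \<Rightarrow> nat \<Rightarrow> nat) \<Rightarrow> nat set set" where
  "doubled_blocks v B f = B \<union> {{a, x, y} | a x y. a \<in> {..<v} \<and> {x, y} \<in> factor v f a}"

text \<open>An unordered edge may have been built from its ends in either order; symmetry of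
  \<open>f\<close> allows \<open>p\<close> to come first.\<close>

lemma factor_memI:
  assumes f: "proper_edge_colouring (v + 1) f" and "{p, q} \<in> factor v f a"
  shows "\<exists>x y. x < v + 1 \<and> y < v + 1 \<and> x \<noteq> y \<and> f x y = a \<and> p = v + x \<and> q = v + y"
proof -
  from assms(2) obtain x y where xy: "{p, q} = {v + x, v + y}" "x < v + 1" "y < v + 1" "x \<noteq> y" "f x y = a"
    unfolding factor_def by blast
  moreover have "f y x = a"
    using f xy unfolding proper_edge_colouring_def by auto
  ultimately show ?thesis
    by (auto simp: doubleton_eq_iff)
qed

lemma one_factorization_factor:
  assumes f: "proper_edge_colouring (v + 1) f"
  shows "one_factorization {v..<2 * v + 1} {..<v} (factor v f)"
proof -
  let ?Y = "{v..<2 * v + 1}"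
  have sub: "factor v f a \<subseteq> complete_graph_edges ?Y" for a
    unfolding factor_def complete_graph_edges_def by auto
  have "one_factor ?Y (factor v f a)" if "a < v" for a
    unfolding one_factor_def
  proof (intro conjI ballI sub)
    fix p assume "p \<in> ?Y"
    then have p: "v \<le> p" "p < 2 * v + 1"
      by simp_all
    define x where "x = p - v"
    then have x: "p = v + x" "x < v + 1"
      using p by linarith+
    have "\<exists>!y. y < v + 1 \<and> y \<noteq> x \<and> f x y = a"
      using proper_edge_colouring_ex1[OF f x(2), of a] \<open>a < v\<close> by simp
    then obtain y where y: "y < v + 1" "y \<noteq> x" "f x y = a"
      and uniq: "\<And>z. z < v + 1 \<Longrightarrow> z \<noteq> x \<Longrightarrow> f x z = a \<Longrightarrow> z = y"
      by blast
    show "\<exists>!e. e \<in> factor v f a \<and> p \<in> e"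
    proof (rule ex1I[of _ "{p, v + y}"])
      show "{p, v + y} \<in> factor v f a \<and> p \<in> {p, v + y}"
        using x y unfolding factor_def by blast
    next
      fix e assume e: "e \<in> factor v f a \<and> p \<in> e"
      then obtain q where "e = {p, q}"
        unfolding factor_def by auto
      then obtain x' z where "x' < v + 1" "z < v + 1" "x' \<noteq> z" "f x' z = a" "p = v + x'" "q = v + z"
        using factor_memI[OF f, of p q a] e by blast
      then show "e = {p, v + y}"
        using uniq[of z] x \<open>e = {p, q}\<close> by auto
    qed
  qed
  moreover have "disjoint_family_on (factor v f) {..<v}"
  proof -
    have "a = b" if e: "e \<in> factor v f a" "e \<in> factor v f b" for a b e
    proof -
      obtain x y where xy: "e = {v + x, v + y}" "x < v + 1" "y < v + 1" "x \<noteq> y" "f x y = a"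
        using e(1) unfolding factor_def by blast
      then show ?thesis
        using factor_memI[OF f, of "v + x" "v + y" b] e(2) by auto
    qed
    then show ?thesis
      unfolding disjoint_family_on_def by blast
  qed
  moreover have "complete_graph_edges ?Y \<subseteq> (\<Union>a\<in>{..<v}. factor v f a)"
  proof
    fix e assume "e \<in> complete_graph_edges ?Y"
    then obtain p q where "e = {p, q}" "p \<noteq> q" "p \<in> ?Y" "q \<in> ?Y"
      unfolding complete_graph_edges_def by (auto simp: card_2_iff)
    moreover obtain x y where "p = v + x" "q = v + y"
      using calculation(3,4) that[of "p - v" "q - v"] by auto
    ultimately have xy: "e = {v + x, v + y}" "x \<noteq> y" "x < v + 1" "y < v + 1"
      by auto
    then have "f x y < v"
      using f unfolding proper_edge_colouring_def by auto
    then show "e \<in> (\<Union>a\<in>{..<v}. factor v f a)"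
      using xy unfolding factor_def by blast
  qed
  ultimately show ?thesis
    using sub unfolding one_factorization_def by blast
qed

lemma doubling_construction_doubled_blocks:
  assumes "proper_edge_colouring (v + 1) f"
  shows "doubling_construction {..<v} B {v..<2 * v + 1} (doubled_blocks v B f)"
  using one_factorization_factor[OF assms]
  unfolding doubling_construction_def doubled_blocks_def by (auto intro!: exI[of _ "factor v f"])

section \<open>Bicolorings of doubled systems\<close>

definition two_coloured :: "nat \<Rightarrow> nat \<Rightarrow> nat \<Rightarrow> bool" where
  "two_coloured a b c \<longleftrightarrow> a = b \<and> b \<noteq> c \<or> a \<noteq> b \<and> (c = a \<or> c = b)"

text \<open>Links a test that can be evaluated on tables to the cardinality that
  \<open>strict_bicoloring\<close> asks for.\<close>

lemma two_coloured_iff_card: "two_coloured a b c \<longleftrightarrow> card {a, b, c} = 2"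
  unfolding two_coloured_def by (auto simp: card_insert_if)

text \<open>The number of colours stays open; it is recovered as the size of the image of
  \<open>C\<close> where it matters.\<close>

definition bicoloured_sts :: "nat \<Rightarrow> nat set set \<Rightarrow> (nat \<Rightarrow> nat) \<Rightarrow> bool" where
  "bicoloured_sts v B C \<longleftrightarrow> steiner_triple_system v {..<v} B \<and> (\<forall>T\<in>B. card (C ` T) = 2)"

definition glue :: "nat \<Rightarrow> (nat \<Rightarrow> nat) \<Rightarrow> (nat \<Rightarrow> nat) \<Rightarrow> nat \<Rightarrow> nat" where
  "glue v C D x = (if x < v then C x else D (x - v))"

lemma glue_simps [simp]: "x < v \<Longrightarrow> glue v C D x = C x" "glue v C D (v + x) = D x"
  by (simp_all add: glue_def)

lemma Un_upper_half: "{..<v} \<union> {v..<2 * v + 1} = {..<2 * v + 1}" for v :: nat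
  by auto

lemma glue_image: "glue v C D ` {v..<2 * v + 1} = D ` {..<v + 1}"
proof -
  have "{v..<2 * v + 1} = (\<lambda>x. v + x) ` {..<v + 1}"
    by (simp add: lessThan_atLeast0 image_add_atLeastLessThan mult_2)
  then show ?thesis
    by (simp add: image_image)
qed

text \<open>Old triples keep their colours, and a new triple on the edge \<open>x\<close>,
  \<open>y\<close> shows the colours \<open>C (f x y)\<close>, \<open>D x\<close>,
  \<open>D y\<close>. Since \<open>D\<close> is not tied to the old colours, the lemma serves the
  extended colouring, the colouring with one fresh colour, and the standard doubling.\<close>

lemma bicoloured_sts_doubled:
  assumes B: "bicoloured_sts v B C" and f: "proper_edge_colouring (v + 1) f"
    and two: "\<And>x y. x < v + 1 \<Longrightarrow> y < v + 1 \<Longrightarrow> x \<noteq> y \<Longrightarrow> two_coloured (C (f x y)) (D x) (D y)"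
  shows "bicoloured_sts (2 * v + 1) (doubled_blocks v B f) (glue v C D)"
  unfolding bicoloured_sts_def
proof (intro conjI ballI)
  have S: "steiner_triple_system v {..<v} B"
    using B unfolding bicoloured_sts_def by blast
  show "steiner_triple_system (2 * v + 1) {..<2 * v + 1} (doubled_blocks v B f)"
    using doubling_construction_steiner[OF S doubling_construction_doubled_blocks[OF f]]
    unfolding Un_upper_half .
  fix T assume "T \<in> doubled_blocks v B f"
  then consider "T \<in> B" | a p q where "T = {a, p, q}" "a < v" "{p, q} \<in> factor v f a"
    unfolding doubled_blocks_def by blast
  then show "card (glue v C D ` T) = 2"
  proof cases
    case 1
    then have "card (C ` T) = 2"
      using B unfolding bicoloured_sts_def by simp
    moreover have "T \<subseteq> {..<v}"
      using S 1 unfolding steiner_triple_system_def by simp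
    moreover have "glue v C D ` T = C ` T"
      using \<open>T \<subseteq> {..<v}\<close> by (intro image_cong) auto
    ultimately show ?thesis
      by simp
  next
    case 2
    then obtain x y where "x < v + 1" "y < v + 1" "x \<noteq> y" "f x y = a" "p = v + x" "q = v + y"
      using factor_memI[OF f 2(3)] by blast
    then show ?thesis
      using two[of x y] 2 by (simp add: two_coloured_iff_card)
  qed
qed

text \<open>An extended bicoloring of some doubling, expressed through the edge colouring alone, so
  that neither the new points nor the new triples have to be mentioned.\<close>

definition extendable :: "nat \<Rightarrow> bool" where
  "extendable v \<longleftrightarrow> (\<exists>B C f D. bicoloured_sts v B C \<and> proper_edge_colouring (v + 1) f \<and>
     D ` {..<v + 1} \<subseteq> C ` {..<v} \<and>
     (\<forall>x<v + 1. \<forall>y<v + 1. x \<noteq> y \<longrightarrow> two_coloured (C (f x y)) (D x) (D y)))"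

section \<open>Two numbers of colours on one system\<close>

lemma lower_neq_upper_chromatic_number:
  assumes "finite V" "bicolorable_with V B k" "bicolorable_with V B l" "k < l"
  shows "lower_chromatic_number V B \<noteq> upper_chromatic_number V B"
proof -
  \<comment> \<open>Without an upper bound on the attained numbers, \<open>GREATEST\<close> would be
    unspecified.\<close>
  have bound: "m \<le> card V" if "bicolorable_with V B m" for m
    using that assms(1) card_image_le unfolding bicolorable_with_def strict_bicoloring_def by blast
  have "lower_chromatic_number V B \<le> k"
    unfolding lower_chromatic_number_def using assms(2) by (rule Least_le)
  moreover have "l \<le> upper_chromatic_number V B"
    unfolding upper_chromatic_number_def using assms(3) bound by (rule Greatest_le_nat)
  ultimately show ?thesis
    using assms(4) by linarith
qed

lemma fresh_colour: "\<exists>N :: nat. N \<notin> C ` {..<v :: nat}"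
  by (rule ex_new_if_finite) auto

lemma extendable_doubling:
  assumes "extendable v" and w: "w = 2 * v + 1"
  shows "(\<exists>(V :: nat set) B Y B' k (C :: nat \<Rightarrow> nat) C'.
            steiner_triple_system ((w - 1) div 2) V B \<and>
            doubling_construction V B Y B' \<and>
            steiner_triple_system w (V \<union> Y) B' \<and>
            extended_bicoloring k V B C Y B' C') \<and>
         (\<exists>(V :: nat set) B.
            steiner_triple_system w V B \<and>
            bicolorable V B \<and>
            lower_chromatic_number V B \<noteq> upper_chromatic_number V B)"
proof -
  obtain B C f D where B: "bicoloured_sts v B C" and f: "proper_edge_colouring (v + 1) f"
    and D: "D ` {..<v + 1} \<subseteq> C ` {..<v}"
    and "\<forall>x<v + 1. \<forall>y<v + 1. x \<noteq> y \<longrightarrow> two_coloured (C (f x y)) (D x) (D y)"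
    using assms(1) unfolding extendable_def by (elim exE conjE) (rule that)
  then have two: "two_coloured (C (f x y)) (D x) (D y)" if "x < v + 1" "y < v + 1" "x \<noteq> y" for x y
    using that by blast
  define B' where "B' = doubled_blocks v B f"
  define k where "k = card (C ` {..<v})"
  let ?V = "{..<v}" and ?Y = "{v..<2 * v + 1}" and ?W = "{..<2 * v + 1}"
  have S: "steiner_triple_system v ?V B"
    using B unfolding bicoloured_sts_def by blast
  have dbl: "doubling_construction ?V B ?Y B'"
    unfolding B'_def using f by (rule doubling_construction_doubled_blocks)
  \<comment> \<open>Stated for arbitrary \<open>E\<close>, because it is used both for
    \<open>D\<close> and for the constant fresh colour.\<close>
  have image_W: "glue v C E ` ?W = C ` ?V \<union> E ` {..<v + 1}" for E
    unfolding Un_upper_half[symmetric] image_Un glue_image by (simp cong: image_cong_simp)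
  have old: "strict_bicoloring k ?W B' (glue v C D)" and S': "steiner_triple_system (2 * v + 1) ?W B'"
    using bicoloured_sts_doubled[OF B f two] D image_W[of D]
    unfolding bicoloured_sts_def B'_def strict_bicoloring_def k_def by (auto simp: Un_absorb2)
  obtain N where N: "N \<notin> C ` ?V"
    using fresh_colour by blast
  \<comment> \<open>The two ends of an edge share the colour \<open>N\<close>, and the point
    attached to the edge is old and so has another colour.\<close>
  have "two_coloured (C (f x y)) N N" if "x < v + 1" "y < v + 1" "x \<noteq> y" for x y
  proof -
    have "f x y < v"
      using f that unfolding proper_edge_colouring_def by auto
    then show ?thesis
      using N unfolding two_coloured_def by auto
  qed
  then have "bicoloured_sts (2 * v + 1) B' (glue v C (\<lambda>_. N))"
    unfolding B'_def using B f by (intro bicoloured_sts_doubled)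
  moreover have "C ` ?V \<union> (\<lambda>_. N) ` {..<v + 1} = insert N (C ` ?V)"
    by auto
  ultimately have new: "strict_bicoloring (Suc k) ?W B' (glue v C (\<lambda>_. N))"
    using N unfolding bicoloured_sts_def strict_bicoloring_def k_def image_W by simp
  have "strict_bicoloring k ?V B C"
    using B unfolding bicoloured_sts_def strict_bicoloring_def k_def by blast
  then have "extended_bicoloring k ?V B C ?Y B' (glue v C D)"
    using old D glue_image[of v C D] unfolding extended_bicoloring_def Un_upper_half by auto
  moreover have "lower_chromatic_number ?W B' \<noteq> upper_chromatic_number ?W B'" "bicolorable ?W B'"
    using lower_neq_upper_chromatic_number[of ?W B' k "Suc k"] old new
    unfolding bicolorable_with_def bicolorable_def by blast+
  moreover have "(w - 1) div 2 = v" "steiner_triple_system w (?V \<union> ?Y) B'" "steiner_triple_system w ?W B'"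
    using S' unfolding w Un_upper_half by simp_all
  ultimately show ?thesis
    using S dbl by metis
qed

section \<open>Systems with two colour classes covering half the points\<close>

text \<open>No residue modulo 4 is imposed, so that orders 1 (mod 4) can serve as seeds for
  doubling. Both colours have to occur, so that colouring new points with them brings in no further
  colour.\<close>

definition halved :: "nat \<Rightarrow> bool" where
  "halved v \<longleftrightarrow> (\<exists>B C i j. bicoloured_sts v B C \<and> i \<noteq> j \<and> i \<in> C ` {..<v} \<and> j \<in> C ` {..<v} \<and>
     2 * card {x. x < v \<and> C x \<in> {i, j}} = v + 1)"

text \<open>The standard doubling gives \<open>v + x\<close> the colour of \<open>x\<close> and the last point a new colour, so
  every old colour class doubles.\<close>
lemma halved_double:
  assumes "halved v"
  shows "halved (2 * v + 1)"
proof -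
  obtain B C i j where B: "bicoloured_sts v B C" and ij: "i \<noteq> j" "i \<in> C ` {..<v}" "j \<in> C ` {..<v}"
    and half: "2 * card {x. x < v \<and> C x \<in> {i, j}} = v + 1"
    using assms(1) unfolding halved_def by (elim exE conjE) (rule that)
  have S: "steiner_triple_system v {..<v} B"
    using B unfolding bicoloured_sts_def by blast
  have "\<exists>t. \<forall>x y. x < v \<longrightarrow> y < v \<longrightarrow> x \<noteq> y \<longrightarrow> t x y < v \<and> t x y \<noteq> x \<and> t x y \<noteq> y \<and> {x, y, t x y} \<in> B"
    using steiner_third_point[OF S] by (intro choice allI) (metis lessThan_iff)
  then obtain t where t: "\<And>x y. x < v \<Longrightarrow> y < v \<Longrightarrow> x \<noteq> y \<Longrightarrow>
      t x y < v \<and> t x y \<noteq> x \<and> t x y \<noteq> y \<and> {x, y, t x y} \<in> B"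
    by blast
  obtain N where N: "N \<notin> C ` {..<v}"
    using fresh_colour by blast
  \<comment> \<open>The last new point acts as a point at infinity: third points on \<open>x\<close>
    never equal \<open>x\<close>, so the colour \<open>x\<close> is free for the edge from
    \<open>x\<close> to it.\<close>
  define f where "f x y = (if x = v then y else if y = v then x else t x y)" for x y
  define D where "D x = (if x = v then N else C x)" for x
  have t_sym: "t y x = t x y" if "x < v" "y < v" "x \<noteq> y" for x y
  proof -
    have "{y, x, t y x} = {x, y, t x y}"
      using t[of x y] t[of y x] that by (intro steiner_block_eq[OF S, of _ _ x y]) auto
    then show ?thesis
      using t[of x y] t[of y x] that by blast
  qed
  have t_inj: "y = z" if "x < v" "y < v" "z < v" "x \<noteq> y" "x \<noteq> z" "t x y = t x z" for x y z
  proof -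
    \<comment> \<open>Both triples contain \<open>x\<close> and the common third point, and that
      pair lies in a single triple.\<close>
    have "{x, y, t x y} = {x, z, t x z}"
      using t[of x y] t[of x z] that by (intro steiner_block_eq[OF S, of _ _ x "t x y"]) auto
    then show ?thesis
      using t[of x y] t[of x z] that by auto
  qed
  have f: "proper_edge_colouring (v + 1) f"
    unfolding proper_edge_colouring_def
  proof (intro conjI allI impI)
    fix x y assume "x < v + 1" "y < v + 1" "x \<noteq> y"
    then show "f x y < v + 1 - 1" "f y x = f x y"
      using t[of x y] t_sym[of x y] unfolding f_def by auto
  next
    fix x assume "x < v + 1"
    show "inj_on (f x) ({..<v + 1} - {x})"
    proof (rule inj_onI)
      fix y z assume yz: "y \<in> {..<v + 1} - {x}" "z \<in> {..<v + 1} - {x}" and eq: "f x y = f x z"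
      then have less: "u = v \<or> u < v" if "u \<in> {x, y, z}" for u
        using that \<open>x < v + 1\<close> by auto
      show "y = z"
        using less[of x] less[of y] less[of z] yz eq t[of x y] t[of x z] t_inj[of x y z]
        unfolding f_def by (simp split: if_splits)
    qed
  qed
  have two: "two_coloured (C (f x y)) (D x) (D y)" if "x < v + 1" "y < v + 1" "x \<noteq> y" for x y
  proof (cases "x = v \<or> y = v")
    case True
    then show ?thesis
      using that N unfolding f_def D_def two_coloured_def by auto
  next
    case False
    \<comment> \<open>The new points copy the colours of \<open>x\<close> and \<open>y\<close>, so
      the new triple shows the same colours as the old triple through them.\<close>
    then have "card (C ` {x, y, t x y}) = 2"
      using B t[of x y] that unfolding bicoloured_sts_def by auto
    then show ?thesis
      using False that unfolding f_def D_def two_coloured_iff_card by (simp add: insert_commute)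
  qed
  let ?C = "glue v C D"
  have "bicoloured_sts (2 * v + 1) (doubled_blocks v B f) ?C"
    using B f two by (rule bicoloured_sts_doubled)
  moreover have "i \<in> ?C ` {..<2 * v + 1}" "j \<in> ?C ` {..<2 * v + 1}"
    using ij(2,3) unfolding Un_upper_half[symmetric] image_Un by (simp_all cong: image_cong_simp)
  moreover have "2 * card {x. x < 2 * v + 1 \<and> ?C x \<in> {i, j}} = 2 * v + 1 + 1"
  proof -
    let ?H = "{x. x < v \<and> C x \<in> {i, j}}"
    \<comment> \<open>The last point drops out because \<open>N\<close> is neither \<open>i\<close>
      nor \<open>j\<close>. Two copies of the old set remain, and 2 (v + 1) = (2 v + 1) + 1.\<close>
    have "{x. x < 2 * v + 1 \<and> ?C x \<in> {i, j}} = ?H \<union> (\<lambda>x. v + x) ` ?H"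
    proof (intro equalityI subsetI)
      fix x assume x: "x \<in> {x. x < 2 * v + 1 \<and> ?C x \<in> {i, j}}"
      show "x \<in> ?H \<union> (\<lambda>x. v + x) ` ?H"
      proof (cases "x < v")
        case False
        then obtain y where y: "x = v + y"
          using that[of "x - v"] by auto
        then have "y \<noteq> v"
          using x N ij unfolding D_def by auto
        then show ?thesis
          using x y unfolding D_def by auto
      qed (use x in auto)
    qed (auto simp: D_def)
    moreover have "card (?H \<union> (\<lambda>x. v + x) ` ?H) = card ?H + card ((\<lambda>x. v + x) ` ?H)"
      by (rule card_Un_disjoint) auto
    ultimately show ?thesis
      using half by (simp add: card_image)
  qed
  ultimately show ?thesis
    unfolding halved_def using ij(1)
    by (intro exI[of _ "doubled_blocks v B f"] exI[of _ ?C] exI[of _ i] exI[of _ j] conjI)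
qed

section \<open>The round-robin one-factorization\<close>

lemma mod_add_left_cancel_less:
  fixes a b c k :: nat
  assumes "(c + a) mod k = (c + b) mod k" "a < k" "b < k"
  shows "a = b"
  using assms by (metis cong_add_lcancel_nat cong_def mod_less)

lemma mod_double_cancel_less:
  fixes a b k :: nat
  assumes "2 * a mod k = 2 * b mod k" "a < k" "b < k" "odd k"
  shows "a = b"
proof -
  have "[2 * a = 2 * b] (mod k)" "coprime 2 k"
    using assms by (simp_all add: cong_def)
  then show ?thesis
    using assms(2,3) by (metis cong_def cong_mult_lcancel_nat mod_less)
qed

text \<open>The circle method for tournaments: the vertices below n - 1 are residues modulo n - 1,
  and an edge gets the sum of its ends. At \<open>x\<close> this leaves out only the colour 2 x,
  which goes to the edge from \<open>x\<close> to the extra vertex n - 1.\<close>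

definition round_robin :: "nat \<Rightarrow> nat \<Rightarrow> nat \<Rightarrow> nat" where
  "round_robin n x y =
     (if x = n - 1 then 2 * y else if y = n - 1 then 2 * x else x + y) mod (n - 1)"

lemma proper_edge_colouring_round_robin:
  assumes "even n" "n > 0"
  shows "proper_edge_colouring n (round_robin n)"
  unfolding proper_edge_colouring_def
proof (intro conjI allI impI)
  fix x y assume "x < n" "y < n" "x \<noteq> y"
  then show "round_robin n x y < n - 1" "round_robin n y x = round_robin n x y"
    unfolding round_robin_def by (auto simp: add.commute)
next
  fix x assume "x < n"
  have "odd (n - 1)"
    using assms by auto
  show "inj_on (round_robin n x) ({..<n} - {x})"
  proof (rule inj_onI)
    fix y z assume yz: "y \<in> {..<n} - {x}" "z \<in> {..<n} - {x}" and eq: "round_robin n x y = round_robin n x z"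
    then have less: "u = n - 1 \<or> u < n - 1" if "u \<in> {x, y, z}" for u
      using that \<open>x < n\<close> by auto
    show "y = z"
      \<comment> \<open>Edges at the extra vertex differ because doubling is injective modulo the
        odd number n - 1. Elsewhere \<open>x\<close> cancels from the sums, and x + y = 2 x modulo n
        - 1 would give y = x.\<close>
      using yz eq less[of x] less[of y] less[of z]
        mod_double_cancel_less[of y "n - 1" z] mod_add_left_cancel_less[of x y "n - 1" z]
        mod_add_left_cancel_less[of x x "n - 1" z] mod_add_left_cancel_less[of x y "n - 1" x]
        \<open>odd (n - 1)\<close>
      unfolding round_robin_def by (auto simp: mult_2 split: if_splits)
  qed
qed

text \<open>The new points split into two halves of size \<open>m\<close>, coloured \<open>i\<close> and \<open>j\<close>. The \<open>m\<close> old points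
  of colour \<open>i\<close> or \<open>j\<close> take the perfect matchings between the halves, and the other \<open>m - 1\<close> old
  points take one-factors of both halves, which exist because \<open>m\<close> is even.\<close>
lemma halved_extendable:
  assumes "halved v" "v mod 4 = 3"
  shows "extendable v"
proof -
  obtain B C i j where B: "bicoloured_sts v B C" and ij: "i \<noteq> j" "i \<in> C ` {..<v}" "j \<in> C ` {..<v}"
    and half: "2 * card {x. x < v \<and> C x \<in> {i, j}} = v + 1"
    using assms(1) unfolding halved_def by (elim exE conjE) (rule that)
  define W where "W = {x. x < v \<and> C x \<in> {i, j}}"
  define m where "m = card W"
  \<comment> \<open>Evenness of \<open>m\<close> is where v = 3 (mod 4) enters; it allows a round
    robin inside each half.\<close>
  have m: "v + 1 = 2 * m" "even m" "m > 0"
  proof -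
    show "v + 1 = 2 * m"
      using half unfolding m_def W_def by simp
    then show "even m" "m > 0"
      using assms(2) by presburger+
  qed
  have "W \<subseteq> {..<v}"
    unfolding W_def by auto
  then have "card ({..<v} - W) = m - 1"
    using m finite_subset by (subst card_Diff_subset) (auto simp: m_def)
  then obtain \<gamma> where \<gamma>: "bij_betw \<gamma> {..<m - 1} ({..<v} - W)"
    using ex_bij_betw_nat_finite[of "{..<v} - W"] by (auto simp: lessThan_atLeast0)
  obtain \<beta> where \<beta>: "bij_betw \<beta> {..<m} W"
    using ex_bij_betw_nat_finite[of W] finite_subset[OF \<open>W \<subseteq> {..<v}\<close>]
    by (auto simp: lessThan_atLeast0 m_def)
  \<comment> \<open>Reduction modulo \<open>m\<close> identifies both halves with the numbers below
    \<open>m\<close>. One round robin serves both halves at once, so each outside point matches all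
    of Y. Across, the sum modulo \<open>m\<close> is a cyclic Latin square, and each of its values
    is a perfect matching between the halves.\<close>
  define f where "f x y = (if x < m \<longleftrightarrow> y < m then \<gamma> (round_robin m (x mod m) (y mod m))
    else \<beta> ((x + y) mod m))" for x y
  define D where "D x = (if x < m then i else j)" for x
  have rr: "proper_edge_colouring m (round_robin m)"
    using m by (intro proper_edge_colouring_round_robin)
  have mod_neq: "x mod m \<noteq> y mod m" if "x < 2 * m" "y < 2 * m" "x < m \<longleftrightarrow> y < m" "x \<noteq> y" for x y
    using that by (auto simp: mod_if)
  have same: "f x y \<in> {..<v} - W" if "x < 2 * m" "y < 2 * m" "x \<noteq> y" "x < m \<longleftrightarrow> y < m" for x y
  proof -
    have "round_robin m (x mod m) (y mod m) < m - 1"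
      using rr mod_neq[OF that(1,2,4,3)] m unfolding proper_edge_colouring_def by auto
    then show ?thesis
      using bij_betwE[OF \<gamma>] that unfolding f_def by auto
  qed
  have cross: "f x y \<in> W" if "\<not> (x < m \<longleftrightarrow> y < m)" for x y
    using bij_betwE[OF \<beta>] that m unfolding f_def by auto
  have f: "proper_edge_colouring (v + 1) f"
    unfolding proper_edge_colouring_def m(1)
  proof (intro conjI allI impI)
    fix x y assume xy: "x < 2 * m" "y < 2 * m" "x \<noteq> y"
    have "f x y \<in> {..<v}"
      using same[of x y] cross[of x y] xy \<open>W \<subseteq> {..<v}\<close> by (cases "x < m \<longleftrightarrow> y < m") blast+
    then show "f x y < 2 * m - 1"
      using m(1) by simp
    show "f y x = f x y"
      using rr mod_neq[of x y] xy m unfolding f_def proper_edge_colouring_def by (auto simp: add.commute)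
  next
    fix x assume x: "x < 2 * m"
    show "inj_on (f x) ({..<2 * m} - {x})"
    proof (rule inj_onI)
      fix y z assume yz: "y \<in> {..<2 * m} - {x}" "z \<in> {..<2 * m} - {x}" and eq: "f x y = f x z"
      \<comment> \<open>Edges inside a half and edges across use disjoint sets of old points, so
        equal colours at \<open>x\<close> force edges of the same kind.\<close>
      then have iff: "(x < m \<longleftrightarrow> y < m) \<longleftrightarrow> (x < m \<longleftrightarrow> z < m)"
        using same[of x y] cross[of x y] same[of x z] cross[of x z] x by auto
      show "y = z"
      proof (cases "x < m \<longleftrightarrow> y < m")
        case True
        let ?x = "x mod m" and ?y = "y mod m" and ?z = "z mod m"
        have ne: "?y \<noteq> ?x" "?z \<noteq> ?x"
          using mod_neq[of y x] mod_neq[of z x] True iff x yz by auto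
        have lt: "?x < m" "?y < m" "?z < m"
          using m by auto
        have "round_robin m ?x ?y < m - 1" "round_robin m ?x ?z < m - 1"
          using rr ne lt unfolding proper_edge_colouring_def by metis+
        moreover have "\<gamma> (round_robin m ?x ?y) = \<gamma> (round_robin m ?x ?z)"
          using eq True iff unfolding f_def by simp
        ultimately have "round_robin m ?x ?y = round_robin m ?x ?z"
          using bij_betw_imp_inj_on[OF \<gamma>] by (auto dest: inj_onD)
        then have "?y = ?z"
          using rr ne lt unfolding proper_edge_colouring_def inj_on_def by blast
        then show ?thesis
          using mod_neq[of y z] True iff yz by auto
      next
        case False
        have "\<beta> ((x + y) mod m) = \<beta> ((x + z) mod m)"
          using eq False iff unfolding f_def by simp
        then have "(x + y) mod m = (x + z) mod m"
          using bij_betw_imp_inj_on[OF \<beta>] m by (auto dest: inj_onD)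
        then have "(x + y mod m) mod m = (x + z mod m) mod m"
          by (simp add: mod_add_right_eq)
        then have "y mod m = z mod m"
          by (rule mod_add_left_cancel_less) (use m in simp_all)
        then show ?thesis
          using mod_neq[of y z] False iff yz by auto
      qed
    qed
  qed
  \<comment> \<open>Across, the ends are coloured \<open>i\<close> and \<open>j\<close> and the old
    point has one of these colours. Inside a half the ends agree and the old point has a third
    colour.\<close>
  have two: "two_coloured (C (f x y)) (D x) (D y)" if xy: "x < v + 1" "y < v + 1" "x \<noteq> y" for x y
    using same[of x y] cross[of x y] xy ij(1) unfolding m(1) W_def D_def two_coloured_def
    by (cases "x < m \<longleftrightarrow> y < m") auto
  have "D ` {..<v + 1} \<subseteq> C ` {..<v}"
    using ij unfolding D_def by auto
  with B f two show ?thesis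
    unfolding extendable_def
    by (intro exI[of _ B] exI[of _ C] exI[of _ f] exI[of _ D] conjI allI impI)
qed

section \<open>Checking explicit tables\<close>

text \<open>A symmetric function on pairs below \<open>n\<close> is given by the rows of its strict upper triangle.\<close>
definition entry :: "nat list list \<Rightarrow> nat \<Rightarrow> nat \<Rightarrow> nat" where
  "entry U x y = (if x < y then U ! x ! (y - Suc x) else U ! y ! (x - Suc y))"

text \<open>Walks down the triangle, carrying for every remaining point its column so far (reversed), so
  that each row is completed without lookups.\<close>
fun rows_ok ::
    "(nat \<Rightarrow> nat list \<Rightarrow> nat list \<Rightarrow> bool) \<Rightarrow> nat \<Rightarrow> nat list list \<Rightarrow> nat list list \<Rightarrow> bool" where
  "rows_ok P x (c # cs) (r # rs) \<longleftrightarrow>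
     length r = length cs \<and> P x c r \<and> rows_ok P (x + 1) (map2 (#) r cs) rs"
| "rows_ok P x [] [] \<longleftrightarrow> True"
| "rows_ok P x _ _ \<longleftrightarrow> False"

lemma rows_ok_length: "rows_ok P x cs rs \<Longrightarrow> length cs = length rs"
  by (induction P x cs rs rule: rows_ok.induct) auto

text \<open>The induction needs arbitrary initial columns \<open>cs\<close>: each step pushes one
  entry onto every remaining column, so the entries of the rows passed stand in reverse order in
  front of \<open>cs ! i\<close>.\<close>

lemma rows_ok_nth:
  "rows_ok P x cs rs \<Longrightarrow> i < length rs \<Longrightarrow>
     length (rs ! i) = length rs - Suc i \<and>
     P (x + i) (rev (map (\<lambda>j. rs ! j ! (i - Suc j)) [0..<i]) @ cs ! i) (rs ! i)"
proof (induction P x cs rs arbitrary: i rule: rows_ok.induct)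
  case (1 P x c cs r rs)
  have len: "length cs = length rs" "length r = length cs"
    using 1(2) rows_ok_length[of P x "c # cs" "r # rs"] by auto
  show ?case
  proof (cases i)
    case 0
    then show ?thesis
      using 1(2) len by simp
  next
    case (Suc k)
    \<comment> \<open>The entry of the first row is pushed first and ends up deepest in the
      column.\<close>
    have "rev (map (\<lambda>j. (r # rs) ! j ! (i - Suc j)) [0..<i]) =
        rev (map (\<lambda>j. rs ! j ! (k - Suc j)) [0..<k]) @ [r ! k]"
      unfolding Suc by (simp add: upt_conv_Cons map_Suc_upt[symmetric] comp_def del: upt_Suc)
    then show ?thesis
      using 1(1)[of k] 1(2,3) len Suc by simp
  qed
qed auto

text \<open>With empty initial columns, the predicate sees the complete line of \<open>x\<close> in
  the symmetric table. Later proofs use this and forget the traversal.\<close>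

lemma rows_ok_entry:
  assumes "rows_ok P 0 (map (\<lambda>_. []) U) U" "x < length U"
  shows "P x (map (entry U x) (rev [0..<x])) (map (entry U x) [x + 1..<length U])"
proof -
  have "length (U ! x) = length U - Suc x"
    and P: "P x (rev (map (\<lambda>j. U ! j ! (x - Suc j)) [0..<x])) (U ! x)"
    using rows_ok_nth[OF assms] assms(2) by auto
  then have "U ! x = map (entry U x) [x + 1..<length U]"
    by (intro nth_equalityI) (auto simp: entry_def)
  moreover have "rev (map (\<lambda>j. U ! j ! (x - Suc j)) [0..<x]) = map (entry U x) (rev [0..<x])"
    unfolding rev_map by (intro map_cong) (auto simp: entry_def)
  ultimately show ?thesis
    using P by simp
qed

lemma entry_commute: "x \<noteq> y \<Longrightarrow> entry U y x = entry U x y"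
  unfolding entry_def by auto

lemma zip_map_self: "zip xs (map g xs) = map (\<lambda>x. (x, g x)) xs"
  by (induction xs) auto

lemma two_coloured_commute: "two_coloured b a c = two_coloured a b c" "two_coloured a c b = two_coloured a b c"
  unfolding two_coloured_def by auto

text \<open>The colour classes are consecutive intervals, given by their endpoints.\<close>
fun colour :: "nat list \<Rightarrow> nat \<Rightarrow> nat" where
  "colour [] x = 0"
| "colour (b # bs) x = (if x < b then 0 else colour bs x + 1)"

lemma length_remove1_less [termination_simp]: "length (remove1 x xs) < Suc (length xs)"
  by (auto simp: length_remove1)

text \<open>Applied to the graph of a map. Each pair is cancelled against its reverse, which
  certifies a fixed-point-free involution on a list that shrinks as it is evaluated.\<close>

fun matched :: "(nat \<times> nat) list \<Rightarrow> bool" where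
  "matched [] \<longleftrightarrow> True"
| "matched ((a, b) # ps) \<longleftrightarrow> a \<noteq> b \<and> (b, a) \<in> set ps \<and> matched (remove1 (b, a) ps)"

lemma matched_swap:
  "matched ps \<Longrightarrow> (a, b) \<in> set ps \<Longrightarrow> (b, a) \<in> set ps \<and> a \<noteq> b"
proof (induction ps arbitrary: a b rule: matched.induct)
  case (2 c d ps)
  consider "(a, b) = (c, d)" | "(a, b) = (d, c)" | "(a, b) \<in> set (remove1 (d, c) ps)"
    using 2(3) by (metis in_set_remove1 set_ConsD)
  then show ?case
    using 2(1)[of a b] 2(2) by cases (auto dest: notin_set_remove1)
qed simp

text \<open>For a Steiner triple system the triangle lists the third point of each pair. A row is correct
  when the third-point map of its point is a fixed-point-free involution.\<close>
definition sts_row :: "nat \<Rightarrow> nat list \<Rightarrow> nat \<Rightarrow> nat list \<Rightarrow> nat list \<Rightarrow> bool" where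
  "sts_row n bs x c r \<longleftrightarrow> matched (zip (rev [0..<x]) c @ zip [x + 1..<n] r) \<and>
     (\<forall>(y, z)\<in>set (zip [x + 1..<n] r). two_coloured (colour bs x) (colour bs y) (colour bs z))"

definition sts_table :: "nat list \<Rightarrow> nat list list \<Rightarrow> bool" where
  "sts_table bs U \<longleftrightarrow> rows_ok (sts_row (length U) bs) 0 (map (\<lambda>_. []) U) U"

text \<open>A symmetric operation whose rows are fixed-point-free involutions is totally symmetric,
  and its triples \<open>{x, y, t x y}\<close> form a Steiner triple system. The premise is one
  conjunction, so that a single evaluation settles each table.\<close>

lemma bicoloured_sts_table:
  assumes U: "sts_table bs U \<and> length U = n"
  shows "\<exists>B. bicoloured_sts n B (colour bs)"
proof -
  define t where "t = entry U"
  have row: "sts_row n bs x (map (t x) (rev [0..<x])) (map (t x) [x + 1..<n])" if "x < n" for x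
    using rows_ok_entry[of "sts_row n bs" U x] U that unfolding sts_table_def t_def by blast
  have t_sym: "t y x = t x y" if "x \<noteq> y" for x y
    unfolding t_def using that by (rule entry_commute)
  have t: "t x y < n \<and> t x y \<noteq> x \<and> t x y \<noteq> y \<and> t x (t x y) = y" if "x < n" "y < n" "x \<noteq> y" for x y
  proof -
    let ?ps = "map (\<lambda>y. (y, t x y)) (rev [0..<x] @ [x + 1..<n])"
    have "matched ?ps"
      using row[OF that(1)] unfolding sts_row_def zip_map_self by simp
    moreover have "y \<in> set (rev [0..<x] @ [x + 1..<n])"
      using that by simp linarith
    then have "(y, t x y) \<in> set ?ps"
      unfolding set_map by (rule rev_image_eqI) simp
    ultimately have "(t x y, y) \<in> set ?ps \<and> y \<noteq> t x y"
      by (rule matched_swap)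
    then show ?thesis
      using that by auto
  qed
  have two_less: "two_coloured (colour bs x) (colour bs y) (colour bs (t x y))" if "x < y" "y < n" for x y
    using row[of x] that unfolding sts_row_def zip_map_self by auto
  have two: "two_coloured (colour bs x) (colour bs y) (colour bs (t x y))" if "x < n" "y < n" "x \<noteq> y" for x y
    using two_less[of x y] two_less[of y x] t_sym[of x y] that
    by (cases "x < y") (auto simp: two_coloured_commute(1))
  define B where "B = {{x, y, t x y} | x y. x < n \<and> y < n \<and> x \<noteq> y}"
  have B: "T \<subseteq> {..<n} \<and> card T = 3 \<and> card (colour bs ` T) = 2" if T: "T \<in> B" for T
  proof -
    obtain x y where xy: "T = {x, y, t x y}" "x < n" "y < n" "x \<noteq> y"
      using T unfolding B_def by blast
    then show ?thesis
      using t[of x y] two[of x y] by (simp add: two_coloured_iff_card)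
  qed
  have "\<exists>!T. T \<in> B \<and> P \<subseteq> T" if P: "P \<subseteq> {..<n} \<and> card P = 2" for P
  proof -
    obtain p q where pq: "P = {p, q}" "p \<noteq> q" "p < n" "q < n"
      using P by (auto simp: card_2_iff)
    show ?thesis
    proof (rule ex1I[of _ "{p, q, t p q}"])
      show "{p, q, t p q} \<in> B \<and> P \<subseteq> {p, q, t p q}"
        using pq unfolding B_def by blast
    next
      fix T assume T: "T \<in> B \<and> P \<subseteq> T"
      then obtain x y where xy: "T = {x, y, t x y}" "x < n" "y < n" "x \<noteq> y"
        unfolding B_def by blast
      define z where "z = t x y"
      \<comment> \<open>Total symmetry on a block: any two of its points return the third, so the
        block is recovered from \<open>p\<close> and \<open>q\<close>, whichever two they
        are.\<close>
      have "t x y = z" "t y x = z" "t x z = y" "t z x = y" "t y z = x" "t z y = x"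
        using t[of x y] t[of y x] t_sym[of x y] t_sym[of x z] t_sym[of y z] xy z_def by auto
      moreover have "p \<in> {x, y, z}" "q \<in> {x, y, z}"
        using T pq xy z_def by auto
      ultimately show "T = {p, q, t p q}"
        using pq(2) xy(1) z_def by (elim insertE emptyE) (simp_all add: insert_commute)
    qed
  qed
  then show ?thesis
    unfolding bicoloured_sts_def steiner_triple_system_def using B by (intro exI[of _ B]) auto
qed

text \<open>\<open>c @ r\<close> collects the colours of all edges at \<open>x\<close>, so
  distinctness is properness at this vertex. The range and the two-colour condition are tested once
  per edge, at its smaller end.\<close>

definition factor_row :: "nat \<Rightarrow> nat list \<Rightarrow> nat list \<Rightarrow> nat \<Rightarrow> nat list \<Rightarrow> nat list \<Rightarrow> bool" where
  "factor_row v bs ds x c r \<longleftrightarrow> distinct (c @ r) \<and>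
     (\<forall>(y, a)\<in>set (zip [x + 1..<v + 1] r).
        a < v \<and> two_coloured (colour bs a) (colour ds x) (colour ds y))"

text \<open>\<open>ds\<close> cuts the new points, renumbered from 0, into colour intervals, as
  \<open>bs\<close> does with the old points. The last conjunct keeps \<open>ds\<close> to colours
  in use on the old points.\<close>

definition factor_table :: "nat \<Rightarrow> nat list \<Rightarrow> nat list \<Rightarrow> nat list list \<Rightarrow> bool" where
  "factor_table v bs ds U \<longleftrightarrow> length U = v + 1 \<and>
     rows_ok (factor_row v bs ds) 0 (map (\<lambda>_. []) U) U \<and>
     (\<forall>x\<in>set [0..<v + 1]. \<exists>y\<in>set [0..<v]. colour ds x = colour bs y)"

lemma extendable_table:
  assumes B: "\<exists>B. bicoloured_sts v B (colour bs)" and U: "factor_table v bs ds U"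
  shows "extendable v"
proof -
  define f where "f = entry U"
  have row: "factor_row v bs ds x (map (f x) (rev [0..<x])) (map (f x) [x + 1..<v + 1])"
    if "x < v + 1" for x
    using rows_ok_entry[of "factor_row v bs ds" U x] U that unfolding factor_table_def f_def by auto
  have f_sym: "f y x = f x y" if "x \<noteq> y" for x y
    unfolding f_def using that by (rule entry_commute)
  have less: "f x y < v \<and> two_coloured (colour bs (f x y)) (colour ds x) (colour ds y)"
    if "x < y" "y < v + 1" for x y
    using row[of x] that unfolding factor_row_def zip_map_self by (auto simp del: upt_Suc)
  have f: "f x y < v \<and> two_coloured (colour bs (f x y)) (colour ds x) (colour ds y)"
    if "x < v + 1" "y < v + 1" "x \<noteq> y" for x y
    using less[of x y] less[of y x] f_sym[of x y] that
    by (cases "x < y") (auto simp: two_coloured_commute(2))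
  have "inj_on (f x) ({..<v + 1} - {x})" if "x < v + 1" for x
  proof -
    have "distinct (map (f x) (rev [0..<x] @ [x + 1..<v + 1]))"
      using row[OF that] unfolding factor_row_def map_append by blast
    then have "inj_on (f x) (set (rev [0..<x] @ [x + 1..<v + 1]))"
      unfolding distinct_map by blast
    moreover have "set (rev [0..<x] @ [x + 1..<v + 1]) = {..<v + 1} - {x}"
      using that by auto
    ultimately show ?thesis
      by simp
  qed
  then have "proper_edge_colouring (v + 1) f"
    using f f_sym unfolding proper_edge_colouring_def by simp
  moreover have "colour ds ` {..<v + 1} \<subseteq> colour bs ` {..<v}"
  proof (rule image_subsetI)
    fix x assume "x \<in> {..<v + 1}"
    then have "\<exists>y\<in>set [0..<v]. colour ds x = colour bs y"
      using U unfolding factor_table_def by (simp del: upt_Suc)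
    then show "colour ds x \<in> colour bs ` {..<v}"
      by auto
  qed
  moreover obtain B where "bicoloured_sts v B (colour bs)"
    using B by blast
  ultimately show ?thesis
    unfolding extendable_def using f
    by (intro exI[of _ B] exI[of _ "colour bs"] exI[of _ f] exI[of _ "colour ds"] conjI allI impI) simp_all
qed

definition halving :: "nat \<Rightarrow> nat list \<Rightarrow> nat \<Rightarrow> nat \<Rightarrow> bool" where
  "halving v bs i j \<longleftrightarrow> i \<noteq> j \<and>
     (\<exists>x\<in>set [0..<v]. colour bs x = i) \<and> (\<exists>x\<in>set [0..<v]. colour bs x = j) \<and>
     2 * length (filter (\<lambda>x. colour bs x = i \<or> colour bs x = j) [0..<v]) = v + 1"

lemma halvedI:
  assumes "\<exists>B. bicoloured_sts v B (colour bs)" and h: "halving v bs i j"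
  shows "halved v"
proof -
  obtain B where B: "bicoloured_sts v B (colour bs)"
    using assms(1) by blast
  have "length (filter (\<lambda>x. colour bs x = i \<or> colour bs x = j) [0..<v]) =
      card {x. x < v \<and> colour bs x \<in> {i, j}}"
    by (subst distinct_length_filter) (auto intro: arg_cong[of _ _ card])
  then have "2 * card {x. x < v \<and> colour bs x \<in> {i, j}} = v + 1"
    using h unfolding halving_def by simp
  moreover have "i \<in> colour bs ` {..<v}" "j \<in> colour bs ` {..<v}" "i \<noteq> j"
    using h unfolding halving_def by auto
  ultimately show ?thesis
    unfolding halved_def using B by (intro exI[of _ B] exI[of _ "colour bs"] exI[of _ i] exI[of _ j] conjI)
qed

section \<open>The base systems\<close>

text \<open>The tables were found by randomised hill climbing over two-coloured triples.\<close>

lemma bicoloured_sts_9: "\<exists>B. bicoloured_sts 9 B (colour [4, 8])"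
  by (rule bicoloured_sts_table[where U = "
    [[8, 4, 7, 2, 6, 5, 3, 1], [5, 6, 7, 2, 3, 4, 0], [8, 0, 1, 7, 6, 3], [5, 4, 1, 0, 2], [3, 8,
    1, 6], [0, 8, 7], [2, 4], [5], []]"]) code_simp

text \<open>The classes have 6, 5 and 2 points: 15 + 10 + 1 = 26 monochromatic pairs, one for each
  of the 26 triples. The two smaller classes have 7 = (13 + 1) / 2 points together.\<close>

lemma bicoloured_sts_13: "\<exists>B. bicoloured_sts 13 B (colour [6, 11])"
  by (rule bicoloured_sts_table[where U = "
    [[7, 12, 9, 11, 10, 8, 1, 6, 3, 5, 4, 2], [6, 12, 9, 11, 2, 0, 10, 4, 8, 5, 3], [11, 10, 8, 1,
    9, 5, 7, 4, 3, 0], [8, 7, 10, 5, 4, 0, 6, 2, 1], [12, 7, 6, 3, 1, 2, 0, 5], [9, 3, 2, 6, 0, 1,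
    4], [4, 0, 5, 3, 12, 11], [11, 2, 12, 8, 10], [12, 1, 7, 9], [11, 10, 8], [9, 7], [6], []]"]) code_simp

lemma bicoloured_sts_21: "\<exists>B. bicoloured_sts 21 B (colour [10, 16])"
  by (rule bicoloured_sts_table[where U = "
    [[14, 11, 10, 19, 13, 15, 18, 12, 16, 3, 2, 8, 5, 1, 6, 9, 20, 7, 4, 17], [13, 18, 15, 12, 17,
    11, 19, 10, 9, 7, 5, 2, 0, 4, 20, 6, 3, 8, 16], [16, 12, 19, 10, 14, 17, 15, 6, 0, 4, 1, 7, 9,
    3, 8, 20, 5, 18], [17, 15, 11, 19, 20, 13, 0, 6, 14, 9, 12, 5, 2, 4, 1, 7, 8], [20, 13, 10,
    11, 14, 7, 8, 2, 6, 9, 1, 18, 3, 16, 0, 5], [18, 17, 16, 11, 14, 9, 1, 0, 10, 3, 8, 7, 6, 2,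
    4], [16, 14, 12, 2, 3, 9, 4, 8, 0, 7, 1, 5, 20, 19], [13, 20, 4, 1, 15, 8, 2, 12, 6, 5, 0, 3,
    9], [18, 15, 4, 0, 7, 6, 10, 5, 2, 9, 1, 3], [1, 5, 6, 3, 4, 2, 0, 19, 8, 17, 7], [18, 20, 19,
    5, 8, 17, 16, 11, 13, 12], [17, 16, 19, 20, 13, 12, 10, 14, 15], [18, 3, 7, 19, 11, 13, 16,
    10], [20, 17, 11, 15, 12, 10, 14], [16, 15, 18, 17, 11, 13], [14, 13, 19, 18, 11], [10, 4, 12,
    1], [14, 9, 0], [15, 2], [6], []]"]) code_simp

lemma bicoloured_sts_25: "\<exists>B. bicoloured_sts 25 B (colour [12, 20, 24])"
  by (rule bicoloured_sts_table[where U = "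
    [[19, 23, 24, 18, 22, 13, 15, 16, 17, 12, 14, 10, 6, 11, 7, 8, 9, 4, 1, 21, 20, 5, 2, 3], [16,
    23, 24, 14, 21, 22, 18, 13, 20, 12, 11, 9, 5, 17, 2, 15, 8, 0, 10, 6, 7, 3, 4], [19, 13, 21,
    22, 20, 24, 14, 18, 17, 15, 4, 9, 12, 1, 11, 10, 3, 7, 5, 6, 0, 8], [12, 16, 18, 17, 14, 15,
    13, 21, 4, 10, 8, 9, 5, 7, 6, 2, 22, 11, 20, 1, 0], [17, 16, 19, 20, 22, 14, 15, 3, 2, 10, 11,
    6, 5, 0, 7, 8, 23, 9, 21, 1], [20, 24, 12, 19, 15, 23, 8, 18, 1, 10, 3, 4, 13, 9, 6, 2, 0, 11,
    7], [23, 15, 12, 17, 24, 9, 0, 19, 8, 4, 10, 3, 14, 5, 1, 2, 7, 11], [13, 21, 16, 18, 14, 8,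
    12, 0, 10, 3, 11, 4, 2, 9, 1, 6, 5], [23, 21, 22, 5, 7, 3, 6, 0, 19, 1, 17, 4, 10, 11, 9, 2],
    [24, 20, 6, 1, 2, 3, 18, 0, 16, 5, 11, 7, 4, 8, 10], [19, 0, 3, 4, 5, 7, 6, 2, 11, 1, 8, 23,
    22, 9], [1, 16, 0, 4, 13, 2, 7, 10, 9, 3, 8, 5, 6], [23, 7, 2, 21, 22, 20, 24, 18, 16, 17, 13,
    19], [24, 21, 11, 20, 5, 22, 17, 15, 19, 12, 14], [20, 23, 21, 22, 6, 15, 17, 18, 16, 13],
    [22, 1, 24, 23, 14, 13, 16, 19, 18], [24, 9, 20, 19, 12, 15, 14, 17], [23, 8, 13, 14, 12, 18,
    16], [21, 12, 19, 14, 17, 15], [16, 18, 13, 15, 12], [0, 3, 24, 23], [24, 4, 22], [10, 21],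
    [20], []]"]) code_simp

lemma bicoloured_sts_33: "\<exists>B. bicoloured_sts 33 B (colour [16, 24, 32])"
  by (rule bicoloured_sts_table[where U = "
    [[27, 28, 17, 22, 18, 25, 24, 21, 32, 26, 29, 23, 30, 16, 31, 14, 3, 5, 20, 19, 8, 4, 12, 7,
    6, 10, 1, 2, 11, 13, 15, 9], [19, 18, 26, 29, 16, 20, 30, 22, 25, 31, 32, 21, 28, 24, 6, 23,
    3, 2, 7, 13, 9, 17, 15, 10, 4, 0, 14, 5, 8, 11, 12], [22, 31, 27, 20, 26, 24, 25, 30, 32, 17,
    16, 29, 18, 13, 12, 15, 1, 6, 23, 3, 21, 8, 9, 7, 5, 0, 14, 10, 4, 11], [19, 20, 31, 28, 23,
    26, 24, 27, 16, 29, 21, 32, 12, 0, 1, 4, 5, 14, 2, 8, 10, 30, 9, 11, 7, 13, 25, 6, 15], [21,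
    27, 23, 17, 30, 18, 25, 24, 32, 20, 16, 15, 8, 10, 3, 14, 5, 0, 7, 12, 11, 1, 6, 29, 28, 9, 2,
    13], [24, 30, 32, 31, 16, 23, 19, 28, 26, 25, 10, 22, 0, 12, 3, 4, 17, 11, 6, 15, 14, 2, 13,
    1, 7, 9, 8], [32, 18, 19, 29, 28, 21, 17, 22, 23, 1, 13, 8, 9, 2, 12, 14, 15, 5, 0, 30, 4, 11,
    10, 26, 3, 7], [22, 29, 21, 16, 25, 19, 18, 17, 11, 15, 14, 13, 1, 10, 8, 4, 0, 12, 2, 31, 3,
    9, 5, 27, 6], [16, 27, 26, 29, 20, 19, 28, 9, 4, 6, 14, 13, 0, 7, 3, 2, 31, 11, 10, 15, 12, 1,
    25, 5], [23, 18, 20, 27, 17, 21, 8, 14, 11, 6, 12, 15, 1, 10, 28, 2, 3, 13, 24, 7, 4, 5, 0],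
    [17, 28, 31, 32, 20, 5, 11, 4, 22, 15, 7, 19, 9, 3, 1, 0, 8, 12, 6, 2, 13, 14], [22, 24, 30,
    19, 7, 10, 9, 15, 21, 20, 12, 5, 13, 4, 8, 3, 6, 0, 14, 1, 2], [18, 31, 26, 3, 2, 13, 5, 9, 6,
    11, 0, 4, 7, 15, 30, 10, 8, 27, 14, 1], [23, 22, 2, 6, 12, 7, 8, 1, 15, 14, 11, 26, 25, 9, 5,
    3, 0, 10, 4], [27, 0, 9, 7, 8, 4, 3, 6, 13, 25, 24, 5, 15, 1, 2, 11, 12, 10], [4, 7, 2, 11,
    10, 9, 13, 6, 1, 5, 12, 14, 8, 30, 29, 0, 3], [32, 31, 28, 26, 25, 27, 29, 30, 21, 20, 22, 19,
    23, 24, 18, 17], [25, 30, 28, 24, 5, 1, 21, 18, 31, 29, 20, 27, 19, 26, 16], [32, 27, 30, 29,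
    24, 23, 17, 28, 20, 26, 22, 21, 16, 19], [0, 26, 10, 31, 29, 27, 21, 25, 16, 24, 17, 23, 18],
    [11, 30, 32, 31, 29, 16, 18, 17, 25, 22, 24, 23], [32, 2, 17, 16, 19, 28, 27, 31, 18, 29, 22],
    [25, 26, 23, 24, 16, 31, 18, 20, 28, 21], [18, 22, 27, 26, 30, 16, 28, 19, 20], [14, 22, 32,
    9, 19, 16, 20, 27], [13, 19, 32, 20, 3, 8, 28], [23, 18, 32, 6, 17, 29], [21, 17, 12, 7, 24],
    [4, 23, 22, 25], [15, 21, 26], [32, 31], [30], []]"]) code_simp

lemma bicoloured_sts_37: "\<exists>B. bicoloured_sts 37 B (colour [16, 30, 35])"
  by (rule bicoloured_sts_table[where U = "
    [[32, 30, 24, 31, 29, 23, 16, 20, 27, 34, 33, 36, 22, 35, 19, 7, 18, 17, 15, 8, 25, 13, 6, 3,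
    21, 28, 9, 26, 5, 2, 4, 1, 11, 10, 14, 12], [34, 33, 35, 19, 22, 17, 36, 26, 28, 30, 25, 31,
    24, 16, 15, 7, 20, 5, 18, 29, 6, 27, 14, 12, 9, 23, 10, 21, 11, 13, 0, 3, 2, 4, 8], [19, 27,
    20, 33, 21, 35, 32, 36, 25, 26, 23, 29, 31, 18, 22, 16, 3, 5, 7, 17, 13, 28, 11, 12, 4, 24,
    14, 0, 15, 9, 6, 1, 8, 10], [30, 35, 26, 36, 23, 29, 18, 22, 31, 34, 28, 32, 17, 16, 10, 2,
    21, 20, 11, 8, 0, 27, 6, 25, 14, 9, 4, 12, 15, 1, 13, 5, 7], [25, 34, 32, 29, 36, 22, 17, 21,
    19, 23, 33, 26, 11, 28, 13, 24, 12, 10, 14, 20, 5, 16, 2, 18, 8, 3, 0, 7, 15, 6, 1, 9], [36,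
    24, 32, 16, 26, 31, 30, 18, 27, 21, 9, 28, 13, 1, 2, 15, 23, 22, 7, 4, 10, 14, 17, 0, 12, 11,
    8, 34, 33, 3, 6], [27, 18, 35, 31, 19, 32, 30, 16, 17, 14, 15, 8, 11, 29, 28, 1, 0, 25, 24, 3,
    7, 21, 20, 13, 10, 12, 2, 4, 9, 5], [31, 30, 33, 26, 35, 20, 25, 34, 0, 1, 23, 28, 13, 2, 29,
    18, 5, 14, 11, 6, 19, 22, 9, 8, 4, 10, 15, 12, 3], [33, 21, 34, 28, 25, 17, 30, 19, 14, 6, 16,
    0, 10, 24, 3, 22, 13, 27, 26, 12, 4, 15, 7, 5, 9, 11, 2, 1], [20, 18, 34, 24, 31, 28, 5, 19,
    11, 17, 10, 23, 25, 21, 13, 22, 1, 0, 15, 3, 7, 14, 2, 8, 12, 6, 4], [32, 16, 29, 30, 35, 12,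
    23, 3, 25, 9, 8, 4, 17, 27, 19, 5, 24, 1, 13, 14, 6, 11, 7, 0, 15, 2], [24, 35, 21, 36, 29, 4,
    9, 6, 23, 14, 3, 20, 12, 2, 7, 28, 27, 16, 1, 5, 10, 0, 8, 13, 15], [17, 33, 22, 10, 13, 19,
    18, 27, 4, 15, 29, 11, 1, 2, 20, 8, 23, 5, 3, 6, 14, 9, 7, 0], [36, 27, 28, 12, 5, 4, 7, 26,
    0, 2, 9, 8, 21, 15, 16, 10, 6, 1, 33, 32, 3, 11, 14], [20, 6, 8, 22, 26, 15, 11, 18, 4, 1, 7,
    19, 5, 3, 2, 10, 9, 34, 12, 32, 0, 13], [1, 6, 24, 0, 14, 5, 12, 25, 18, 23, 29, 13, 9, 26, 8,
    2, 3, 4, 7, 10, 11], [3, 2, 8, 31, 32, 30, 34, 33, 35, 4, 36, 13, 11, 22, 20, 21, 24, 23, 25,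
    27], [0, 9, 34, 30, 2, 10, 36, 31, 35, 33, 5, 32, 21, 25, 29, 27, 20, 26, 24], [12, 1, 36, 14,
    7, 15, 32, 33, 35, 4, 34, 31, 30, 25, 26, 29, 27, 21], [32, 31, 36, 33, 34, 10, 14, 30, 7, 35,
    27, 21, 20, 23, 24, 29, 22], [3, 35, 11, 4, 36, 30, 12, 33, 6, 26, 16, 19, 28, 17, 22, 25],
    [33, 9, 35, 0, 13, 34, 6, 1, 17, 19, 16, 22, 27, 24, 18], [5, 8, 9, 31, 32, 34, 7, 16, 26, 27,
    21, 28, 20, 19], [31, 15, 36, 1, 35, 12, 32, 24, 30, 19, 16, 28, 26], [6, 32, 10, 2, 30, 29,
    23, 26, 16, 19, 21, 17], [34, 3, 30, 33, 28, 17, 18, 29, 26, 16, 20], [8, 0, 15, 20, 22, 24,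
    18, 25, 17, 23], [11, 31, 19, 29, 22, 17, 21, 18, 16], [36, 25, 32, 31, 20, 22, 23, 29], [24,
    27, 17, 25, 18, 19, 28], [18, 23, 35, 36, 33, 34], [28, 36, 35, 34, 33], [13, 14, 36, 35], [5,
    30, 31], [31, 30], [32], []]"]) code_simp

text \<open>The class sizes are 22, 13, 6 and 4, and no two of them add up to 23. This system and
  the one of order 49 only carry explicit edge colourings.\<close>

lemma bicoloured_sts_45: "\<exists>B. bicoloured_sts 45 B (colour [22, 35, 41])"
  by (rule bicoloured_sts_table[where U = "
    [[32, 42, 44, 35, 39, 36, 29, 40, 27, 38, 22, 30, 43, 41, 33, 24, 37, 28, 25, 23, 26, 11, 20,
    16, 19, 21, 9, 18, 7, 12, 34, 1, 15, 31, 4, 6, 17, 10, 5, 8, 14, 2, 13, 3], [37, 31, 33, 27,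
    42, 44, 36, 41, 34, 39, 40, 25, 30, 24, 28, 26, 43, 38, 35, 29, 23, 22, 15, 13, 17, 5, 16, 21,
    14, 3, 0, 4, 10, 20, 8, 2, 19, 11, 12, 9, 6, 18, 7], [39, 38, 43, 28, 22, 35, 32, 23, 33, 41,
    36, 29, 26, 30, 31, 44, 34, 24, 40, 7, 10, 20, 27, 15, 25, 6, 14, 16, 17, 9, 11, 19, 8, 13, 1,
    4, 3, 21, 12, 0, 5, 18], [24, 34, 29, 27, 30, 28, 25, 32, 43, 35, 22, 37, 33, 38, 41, 36, 40,
    42, 14, 26, 4, 10, 23, 7, 9, 6, 8, 1, 11, 16, 5, 13, 19, 15, 17, 2, 20, 18, 21, 12, 0], [25,
    40, 32, 41, 42, 39, 36, 37, 23, 31, 43, 22, 30, 27, 29, 34, 44, 16, 13, 3, 5, 28, 18, 26, 19,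
    17, 14, 7, 1, 20, 0, 11, 12, 2, 10, 6, 8, 9, 15, 21], [38, 41, 24, 37, 44, 30, 22, 29, 26, 40,
    35, 36, 42, 28, 32, 23, 12, 21, 8, 4, 14, 1, 19, 13, 11, 33, 20, 31, 3, 16, 17, 9, 6, 0, 15,
    7, 18, 2, 10], [31, 25, 22, 32, 37, 35, 27, 23, 41, 39, 33, 24, 43, 44, 30, 9, 14, 18, 8, 34,
    13, 2, 3, 21, 7, 10, 17, 26, 12, 0, 11, 5, 16, 4, 15, 1, 19, 20], [37, 36, 26, 43, 28, 40, 34,
    35, 23, 24, 38, 33, 42, 39, 2, 16, 17, 30, 10, 3, 12, 0, 25, 6, 4, 19, 14, 15, 9, 8, 18, 21,
    13, 5, 20, 11, 1], [44, 42, 29, 23, 33, 43, 38, 27, 28, 32, 39, 31, 34, 26, 12, 5, 6, 22, 16,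
    17, 11, 3, 20, 18, 13, 21, 2, 1, 7, 15, 19, 0, 4, 10, 14, 9], [43, 35, 39, 31, 33, 25, 40, 34,
    26, 30, 29, 38, 6, 24, 23, 15, 18, 0, 3, 20, 19, 13, 2, 14, 17, 11, 7, 5, 21, 12, 16, 1, 4,
    10, 8], [41, 29, 37, 36, 30, 31, 27, 40, 35, 28, 33, 24, 2, 22, 3, 7, 17, 20, 12, 15, 16, 6,
    21, 1, 19, 14, 13, 0, 4, 18, 11, 8, 9, 5], [27, 26, 40, 23, 25, 42, 31, 44, 38, 28, 0, 15, 34,
    16, 13, 12, 21, 8, 5, 18, 3, 2, 24, 9, 4, 6, 20, 1, 14, 10, 17, 7, 19], [34, 38, 42, 36, 44,
    25, 32, 33, 31, 5, 8, 26, 18, 24, 11, 7, 10, 0, 21, 19, 20, 13, 6, 16, 4, 14, 9, 1, 2, 15, 3,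
    17], [44, 32, 38, 41, 30, 42, 39, 24, 28, 4, 21, 1, 11, 6, 22, 5, 18, 9, 15, 8, 12, 3, 2, 10,
    16, 20, 7, 17, 19, 0, 14], [28, 42, 39, 37, 24, 25, 35, 3, 6, 19, 20, 5, 32, 15, 2, 1, 4, 27,
    9, 7, 21, 10, 18, 12, 17, 11, 0, 16, 8, 13], [44, 22, 39, 31, 36, 27, 17, 11, 1, 9, 2, 21, 14,
    34, 10, 19, 13, 0, 29, 7, 20, 3, 8, 18, 5, 6, 12, 4, 16], [29, 34, 37, 41, 43, 4, 7, 0, 11,
    32, 8, 1, 17, 2, 10, 26, 3, 18, 5, 12, 19, 13, 6, 9, 20, 14, 21, 15], [35, 40, 43, 32, 15, 25,
    7, 23, 1, 10, 8, 16, 4, 2, 21, 6, 9, 18, 5, 0, 3, 14, 19, 13, 11, 20, 12], [23, 22, 36, 20,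
    19, 6, 12, 9, 4, 0, 33, 13, 11, 8, 29, 16, 17, 21, 14, 7, 15, 10, 3, 5, 1, 2], [26, 41, 27,
    18, 14, 0, 20, 22, 5, 4, 9, 15, 12, 7, 2, 10, 3, 16, 1, 8, 17, 21, 13, 6, 11], [37, 18, 0, 2,
    14, 19, 30, 10, 9, 27, 8, 5, 12, 4, 1, 15, 21, 11, 13, 3, 16, 7, 17, 6], [25, 5, 13, 22, 0,
    15, 11, 1, 6, 12, 17, 10, 8, 14, 18, 20, 9, 7, 2, 19, 3, 16, 4], [1, 10, 21, 8, 19, 13, 42,
    39, 38, 43, 41, 44, 40, 37, 36, 31, 30, 35, 33, 29, 32, 34], [9, 17, 3, 37, 40, 44, 38, 39,
    36, 42, 35, 34, 32, 27, 30, 31, 28, 43, 33, 41, 29], [40, 12, 42, 44, 37, 41, 43, 38, 39, 11,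
    36, 35, 29, 32, 33, 25, 30, 27, 31, 28], [35, 2, 41, 38, 7, 44, 42, 36, 43, 26, 33, 39, 29,
    37, 24, 28, 32, 34, 31], [40, 4, 39, 37, 41, 16, 43, 6, 25, 38, 30, 36, 29, 27, 31, 44, 33,
    42], [39, 43, 20, 36, 14, 44, 41, 38, 31, 23, 35, 28, 26, 34, 24, 29, 33], [36, 43, 37, 35,
    38, 42, 32, 29, 31, 33, 27, 23, 25, 34, 30, 24], [40, 35, 41, 18, 15, 31, 28, 24, 25, 26, 30,
    32, 22, 27, 23], [42, 44, 35, 36, 33, 34, 26, 23, 22, 29, 24, 31, 28, 32], [40, 5, 0, 29, 27,
    28, 22, 23, 32, 26, 30, 24, 25], [37, 39, 28, 23, 33, 24, 34, 31, 29, 25, 22, 30], [40, 30,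
    25, 32, 28, 24, 34, 22, 23, 26, 27], [23, 30, 38, 37, 32, 33, 27, 28, 25, 22], [24, 44, 27,
    41, 22, 39, 43, 42, 37], [22, 26, 43, 42, 44, 40, 39, 41], [34, 25, 43, 42, 41, 40, 35], [42,
    41, 40, 39, 44, 43], [44, 35, 38, 36, 40], [38, 36, 37, 39], [37, 23, 36], [35, 26], [38], []]"]) code_simp

lemma bicoloured_sts_49: "\<exists>B. bicoloured_sts 49 B (colour [24, 38, 44])"
  by (rule bicoloured_sts_table[where U = "
    [[43, 36, 44, 46, 41, 33, 38, 24, 47, 48, 29, 40, 31, 42, 25, 34, 26, 39, 45, 32, 27, 35, 28,
    8, 15, 17, 21, 23, 11, 37, 13, 20, 6, 16, 22, 2, 30, 7, 18, 12, 5, 14, 1, 3, 19, 4, 9, 10],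
    [35, 37, 29, 48, 39, 47, 45, 36, 38, 41, 42, 33, 27, 34, 44, 31, 46, 32, 25, 26, 30, 40, 28,
    20, 21, 14, 24, 4, 22, 17, 19, 13, 15, 2, 9, 3, 10, 6, 23, 11, 12, 0, 16, 8, 18, 7, 5], [43,
    41, 45, 29, 25, 34, 30, 33, 26, 48, 47, 24, 32, 40, 42, 27, 46, 38, 39, 44, 31, 14, 7, 11, 18,
    37, 6, 9, 23, 15, 10, 8, 1, 0, 28, 20, 21, 16, 4, 17, 3, 22, 5, 19, 13, 12], [45, 47, 27, 40,
    32, 29, 28, 39, 30, 42, 41, 36, 38, 25, 33, 48, 46, 34, 26, 24, 23, 17, 22, 6, 10, 9, 12, 35,
    8, 18, 21, 31, 15, 1, 16, 11, 7, 14, 13, 2, 0, 4, 20, 5, 19], [27, 32, 43, 47, 35, 26, 25, 33,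
    28, 39, 38, 37, 40, 31, 42, 30, 48, 34, 44, 36, 11, 10, 5, 13, 1, 20, 18, 6, 12, 22, 9, 24,
    16, 15, 14, 17, 2, 19, 7, 23, 3, 0, 8, 21], [38, 39, 33, 26, 46, 36, 24, 32, 30, 42, 35, 44,
    40, 31, 34, 28, 43, 29, 12, 37, 9, 4, 21, 23, 14, 19, 13, 8, 20, 16, 11, 25, 6, 7, 18, 0, 15,
    22, 17, 2, 10, 3, 1], [35, 36, 42, 43, 28, 47, 46, 37, 40, 31, 45, 44, 26, 48, 41, 24, 25, 22,
    23, 19, 3, 11, 2, 34, 16, 4, 0, 30, 7, 8, 14, 5, 1, 15, 21, 9, 10, 18, 17, 13, 12, 20], [48,
    37, 34, 27, 26, 30, 29, 24, 33, 46, 36, 28, 45, 44, 42, 41, 15, 2, 12, 11, 19, 14, 13, 32, 31,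
    16, 10, 6, 18, 9, 0, 5, 3, 23, 22, 4, 21, 20, 17, 1, 8], [38, 42, 31, 46, 44, 26, 41, 43, 27,
    28, 37, 29, 30, 40, 39, 0, 35, 14, 17, 18, 20, 21, 11, 3, 5, 2, 25, 6, 19, 9, 23, 22, 15, 10,
    16, 13, 1, 12, 4, 7], [32, 45, 39, 24, 28, 46, 25, 48, 41, 44, 43, 40, 33, 27, 13, 16, 5, 23,
    14, 3, 2, 34, 10, 22, 31, 4, 1, 7, 8, 12, 21, 18, 6, 20, 19, 11, 15, 0, 17], [40, 36, 37, 25,
    39, 29, 24, 45, 41, 44, 31, 47, 35, 17, 14, 4, 30, 3, 16, 27, 21, 9, 2, 7, 23, 12, 13, 1, 15,
    11, 19, 8, 6, 20, 18, 5, 22, 0], [37, 38, 44, 48, 30, 35, 43, 47, 24, 33, 46, 42, 20, 4, 2, 7,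
    6, 0, 16, 8, 34, 21, 32, 17, 5, 12, 13, 3, 10, 1, 23, 18, 14, 9, 22, 19, 15], [27, 34, 44, 41,
    43, 29, 38, 31, 35, 45, 32, 5, 28, 7, 13, 25, 18, 3, 20, 23, 4, 14, 21, 10, 11, 19, 9, 0, 16,
    1, 17, 15, 22, 8, 6, 2], [48, 35, 36, 41, 25, 34, 40, 45, 39, 43, 9, 18, 29, 12, 4, 26, 7, 0,
    5, 1, 19, 15, 16, 10, 11, 22, 20, 17, 3, 23, 8, 21, 6, 2, 14], [43, 45, 32, 38, 40, 35, 47,
    31, 46, 2, 10, 8, 1, 9, 7, 5, 22, 17, 36, 12, 20, 33, 6, 18, 4, 19, 3, 0, 15, 11, 16, 23, 21,
    13], [47, 30, 26, 33, 28, 29, 37, 45, 7, 0, 18, 31, 20, 21, 17, 27, 2, 19, 1, 13, 3, 22, 4,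
    10, 6, 8, 5, 14, 12, 23, 9, 16, 11], [39, 24, 27, 42, 46, 32, 48, 18, 9, 28, 19, 26, 10, 11,
    6, 22, 7, 0, 5, 13, 4, 3, 17, 2, 12, 20, 8, 1, 14, 21, 15, 23], [34, 36, 33, 37, 38, 47, 10,
    3, 0, 8, 29, 28, 15, 1, 14, 20, 18, 11, 19, 21, 22, 16, 4, 13, 2, 12, 5, 6, 7, 23, 9], [35,
    47, 42, 48, 37, 16, 13, 15, 2, 8, 12, 32, 4, 30, 3, 17, 19, 7, 23, 14, 0, 5, 9, 21, 11, 6, 10,
    1, 20, 22], [39, 43, 29, 30, 25, 24, 6, 16, 7, 22, 23, 5, 1, 15, 13, 18, 17, 8, 12, 20, 14,
    10, 4, 21, 9, 0, 2, 11, 3], [36, 41, 26, 11, 1, 23, 37, 15, 8, 4, 12, 0, 17, 5, 14, 21, 27, 2,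
    19, 13, 22, 16, 9, 10, 7, 3, 18, 6], [25, 38, 32, 22, 1, 0, 5, 15, 8, 10, 24, 11, 3, 12, 20,
    17, 23, 2, 9, 6, 18, 19, 7, 13, 16, 14, 4], [36, 6, 21, 3, 28, 27, 19, 1, 14, 16, 9, 4, 0, 23,
    15, 17, 13, 8, 20, 7, 5, 2, 12, 11, 10, 18], [3, 6, 20, 9, 0, 5, 19, 2, 12, 34, 33, 10, 22,
    18, 21, 8, 1, 7, 11, 13, 4, 15, 14, 17, 16], [19, 42, 38, 1, 44, 48, 41, 21, 47, 39, 46, 4,
    45, 27, 34, 43, 31, 26, 40, 29, 37, 35, 33, 30], [46, 44, 12, 48, 47, 43, 40, 45, 41, 8, 39,
    5, 42, 36, 32, 34, 38, 31, 27, 33, 26, 30, 29], [45, 16, 13, 40, 47, 41, 48, 38, 39, 43, 44,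
    34, 35, 30, 32, 24, 36, 37, 27, 25, 31, 33], [22, 40, 10, 15, 48, 42, 43, 47, 46, 20, 24, 41,
    29, 39, 33, 34, 25, 26, 36, 35, 32], [17, 42, 48, 39, 43, 44, 38, 45, 2, 35, 32, 41, 40, 30,
    33, 34, 36, 47, 46, 31], [43, 45, 46, 39, 47, 42, 38, 41, 36, 33, 27, 37, 35, 30, 24, 31, 32,
    34, 25], [39, 18, 38, 6, 44, 41, 0, 33, 31, 26, 36, 28, 29, 35, 46, 45, 25, 24], [7, 46, 9, 3,
    44, 42, 40, 30, 38, 24, 37, 25, 36, 29, 33, 26, 28], [44, 11, 43, 42, 38, 37, 28, 25, 26, 36,
    35, 33, 47, 29, 45, 27], [23, 41, 14, 40, 30, 29, 37, 35, 27, 28, 32, 25, 31, 24, 26], [45,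
    48, 46, 26, 24, 42, 25, 40, 27, 28, 35, 37, 29, 36], [40, 48, 28, 26, 36, 33, 29, 32, 30, 34,
    24, 27, 37], [47, 29, 25, 35, 30, 32, 26, 31, 28, 27, 37, 34], [32, 43, 33, 29, 31, 39, 26,
    24, 34, 36, 35], [45, 31, 47, 25, 46, 48, 39, 43, 41, 44], [47, 27, 48, 37, 46, 38, 44, 40,
    42], [28, 34, 24, 45, 44, 48, 39, 46], [46, 44, 43, 48, 42, 38, 45], [45, 47, 43, 41, 44, 39],
    [41, 42, 38, 48, 47], [40, 39, 42, 38], [30, 32, 41], [28, 40], [43], []]"]) code_simp

text \<open>Here 63 = 3 (mod 4) and the class sizes 28 and 4 add up to 32, so this system is
  extended directly, without a previous doubling.\<close>

lemma bicoloured_sts_63: "\<exists>B. bicoloured_sts 63 B (colour [28, 50, 59])"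
  by (rule bicoloured_sts_table[where U = "
    [[48, 37, 61, 32, 45, 55, 33, 62, 56, 51, 28, 60, 59, 52, 36, 53, 44, 57, 39, 54, 41, 30, 50,
    40, 35, 58, 43, 11, 34, 22, 38, 4, 7, 29, 25, 15, 2, 31, 19, 24, 21, 47, 27, 17, 5, 49, 42, 1,
    46, 23, 10, 14, 16, 20, 6, 9, 18, 26, 13, 12, 3, 8], [36, 54, 31, 37, 42, 29, 53, 57, 47, 43,
    55, 60, 39, 62, 45, 38, 59, 28, 52, 46, 61, 40, 34, 44, 51, 56, 19, 7, 35, 4, 41, 49, 24, 30,
    2, 5, 17, 14, 23, 32, 6, 11, 25, 16, 21, 10, 0, 33, 58, 26, 20, 8, 3, 12, 27, 9, 50, 18, 13,
    22, 15], [29, 28, 53, 41, 55, 51, 30, 58, 32, 34, 43, 60, 57, 54, 48, 52, 50, 39, 61, 56, 47,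
    62, 59, 40, 35, 4, 3, 9, 45, 11, 42, 12, 27, 1, 0, 46, 20, 26, 6, 33, 13, 49, 31, 38, 23, 17,
    44, 19, 8, 18, 5, 16, 7, 22, 15, 10, 25, 14, 21, 24], [52, 58, 57, 51, 32, 33, 62, 42, 30, 37,
    55, 49, 47, 46, 35, 34, 31, 39, 45, 44, 53, 60, 48, 59, 43, 2, 12, 20, 8, 9, 19, 18, 41, 13,
    40, 21, 38, 36, 11, 28, 23, 22, 17, 16, 26, 15, 56, 7, 4, 24, 1, 14, 50, 6, 5, 27, 25, 0, 10],
    [43, 37, 59, 54, 61, 50, 57, 47, 56, 46, 60, 30, 42, 33, 51, 55, 48, 53, 41, 58, 29, 38, 62,
    2, 25, 16, 1, 0, 18, 49, 45, 40, 6, 26, 44, 36, 23, 17, 5, 39, 35, 14, 12, 21, 34, 10, 19, 3,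
    22, 8, 20, 13, 11, 24, 7, 15, 9, 27], [61, 28, 36, 41, 59, 31, 62, 54, 49, 47, 60, 29, 42, 33,
    56, 51, 38, 55, 50, 52, 57, 44, 7, 17, 39, 11, 48, 19, 46, 40, 8, 1, 22, 30, 35, 9, 18, 4, 27,
    0, 34, 15, 32, 14, 24, 21, 25, 2, 13, 23, 20, 26, 3, 10, 16, 6, 12], [32, 60, 43, 52, 39, 54,
    35, 33, 59, 56, 50, 62, 38, 58, 53, 29, 51, 49, 45, 47, 46, 31, 22, 34, 28, 7, 14, 30, 13, 48,
    4, 19, 11, 44, 2, 1, 9, 40, 25, 27, 26, 36, 24, 17, 23, 10, 21, 12, 0, 16, 3, 20, 15, 8, 5,
    18], [35, 36, 49, 53, 43, 58, 48, 31, 62, 39, 50, 61, 42, 57, 52, 60, 41, 38, 46, 37, 5, 1,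
    44, 15, 6, 0, 40, 8, 9, 27, 25, 17, 34, 24, 20, 12, 30, 47, 26, 45, 14, 10, 18, 3, 22, 11, 56,
    2, 54, 21, 13, 4, 23, 19, 16], [55, 56, 41, 28, 57, 38, 52, 61, 33, 44, 58, 50, 45, 34, 59,
    39, 42, 30, 40, 12, 43, 26, 47, 3, 17, 22, 7, 5, 49, 14, 24, 27, 11, 25, 29, 18, 21, 48, 31,
    46, 37, 20, 2, 15, 1, 4, 9, 10, 13, 19, 23, 6, 16, 0], [60, 48, 44, 46, 50, 28, 52, 37, 39,
    32, 40, 59, 54, 53, 35, 51, 62, 58, 15, 47, 2, 49, 19, 3, 42, 24, 7, 17, 45, 18, 20, 5, 34, 6,
    12, 38, 13, 29, 11, 31, 14, 25, 16, 23, 22, 8, 0, 1, 27, 21, 10, 4, 26], [46, 29, 55, 40, 34,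
    48, 31, 41, 53, 61, 28, 57, 37, 32, 54, 42, 36, 21, 12, 38, 17, 24, 43, 15, 44, 27, 23, 30,
    45, 14, 18, 26, 33, 35, 39, 11, 1, 16, 7, 4, 0, 6, 19, 25, 13, 8, 22, 2, 5, 9, 20, 3], [51,
    61, 59, 58, 55, 60, 45, 56, 62, 50, 49, 52, 44, 40, 54, 33, 0, 38, 47, 5, 2, 27, 36, 37, 34,
    35, 29, 6, 25, 8, 3, 1, 24, 18, 10, 30, 9, 22, 21, 12, 23, 7, 26, 16, 19, 4, 15, 14, 17, 13,
    20], [50, 32, 48, 59, 52, 53, 57, 45, 35, 46, 58, 31, 56, 41, 61, 8, 10, 3, 24, 14, 38, 2, 21,
    42, 39, 33, 37, 49, 26, 36, 7, 9, 20, 22, 4, 15, 40, 13, 11, 17, 18, 6, 1, 25, 19, 23, 16, 0,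
    27, 5], [62, 32, 38, 51, 49, 52, 53, 42, 39, 33, 29, 31, 36, 30, 40, 24, 27, 25, 15, 23, 48,
    6, 26, 3, 16, 22, 28, 45, 21, 2, 47, 41, 9, 44, 34, 18, 12, 17, 19, 20, 5, 10, 4, 8, 7, 0, 1,
    11, 14], [44, 28, 30, 34, 47, 57, 58, 36, 56, 51, 53, 61, 54, 16, 45, 17, 43, 12, 6, 18, 41,
    22, 42, 8, 1, 10, 35, 37, 31, 15, 29, 4, 19, 7, 5, 9, 24, 0, 25, 27, 3, 23, 20, 21, 11, 2, 26,
    13], [33, 41, 51, 46, 38, 37, 50, 61, 56, 30, 45, 53, 9, 40, 25, 7, 13, 16, 10, 42, 0, 21, 20,
    43, 29, 17, 35, 39, 14, 26, 19, 5, 12, 3, 22, 18, 8, 27, 55, 54, 24, 2, 11, 6, 4, 23, 1], [43,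
    58, 44, 51, 29, 42, 39, 57, 50, 35, 34, 14, 21, 4, 32, 31, 15, 27, 26, 49, 46, 13, 23, 41, 40,
    22, 17, 19, 1, 37, 3, 10, 36, 25, 20, 9, 0, 2, 11, 6, 24, 18, 12, 5, 8, 7], [40, 54, 47, 56,
    62, 34, 36, 57, 53, 45, 35, 5, 14, 10, 49, 8, 23, 28, 24, 9, 1, 7, 18, 15, 4, 16, 0, 27, 3,
    20, 2, 32, 6, 13, 12, 26, 19, 58, 21, 25, 55, 61, 11, 59, 22], [60, 48, 38, 55, 31, 54, 61,
    56, 47, 46, 30, 29, 23, 37, 4, 14, 3, 43, 32, 21, 9, 17, 10, 5, 36, 8, 11, 28, 27, 20, 13, 7,
    15, 2, 12, 24, 22, 26, 0, 16, 1, 19, 25, 6], [37, 55, 31, 62, 59, 41, 29, 42, 1, 26, 36, 22,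
    9, 5, 3, 49, 30, 20, 6, 0, 48, 25, 27, 45, 16, 43, 15, 14, 40, 35, 2, 4, 13, 10, 17, 21, 11,
    12, 8, 24, 18, 7, 23], [49, 59, 46, 28, 36, 34, 60, 24, 32, 41, 3, 29, 44, 26, 43, 25, 19, 15,
    2, 9, 30, 7, 35, 33, 12, 23, 17, 18, 21, 8, 16, 1, 13, 0, 4, 5, 14, 6, 22, 27, 10, 11], [60,
    54, 30, 62, 31, 52, 10, 16, 24, 26, 40, 34, 33, 12, 44, 15, 18, 3, 32, 0, 13, 47, 36, 8, 1,
    43, 4, 20, 11, 5, 27, 6, 23, 19, 17, 7, 14, 9, 22, 2, 25], [28, 43, 58, 32, 51, 23, 6, 0, 19,
    26, 35, 8, 33, 14, 41, 5, 13, 47, 37, 16, 24, 48, 3, 12, 40, 44, 11, 15, 27, 7, 4, 9, 18, 2,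
    10, 25, 20, 21, 1, 17], [45, 43, 49, 57, 22, 42, 32, 18, 30, 13, 17, 36, 35, 10, 48, 16, 1, 4,
    29, 25, 3, 24, 20, 2, 38, 26, 0, 6, 11, 9, 21, 5, 14, 27, 12, 8, 7, 15, 19], [33, 52, 55, 20,
    13, 21, 12, 10, 25, 1, 9, 17, 38, 37, 8, 0, 7, 46, 22, 11, 23, 42, 48, 47, 6, 5, 14, 26, 3,
    18, 27, 15, 16, 4, 19, 61, 60, 2], [55, 49, 34, 4, 15, 13, 46, 24, 28, 0, 20, 48, 7, 47, 11,
    19, 8, 23, 1, 6, 32, 39, 37, 27, 16, 9, 5, 14, 10, 26, 12, 17, 22, 2, 3, 18, 21], [50, 44, 19,
    8, 21, 22, 39, 20, 16, 13, 43, 4, 33, 2, 12, 10, 37, 28, 15, 7, 6, 3, 23, 27, 1, 24, 17, 11,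
    25, 18, 5, 0, 60, 59, 14, 9], [29, 28, 13, 48, 39, 11, 16, 2, 10, 7, 41, 32, 8, 38, 19, 0, 5,
    17, 6, 18, 31, 25, 26, 22, 21, 15, 14, 24, 1, 23, 9, 3, 20, 12, 4], [27, 55, 6, 60, 52, 25,
    17, 50, 53, 58, 57, 13, 59, 54, 3, 26, 56, 18, 51, 62, 61, 36, 47, 33, 37, 42, 30, 45, 39, 38,
    41, 32, 49, 48], [18, 55, 20, 60, 0, 54, 59, 61, 11, 53, 15, 51, 23, 8, 62, 14, 56, 9, 58, 50,
    49, 41, 57, 39, 35, 31, 46, 52, 48, 36, 33, 37, 44], [62, 23, 50, 6, 1, 19, 59, 10, 5, 56, 20,
    60, 53, 7, 51, 54, 11, 61, 52, 33, 45, 49, 43, 46, 28, 40, 58, 57, 37, 42, 48, 31], [16, 61,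
    59, 56, 57, 51, 0, 50, 52, 54, 53, 14, 60, 2, 58, 8, 27, 9, 39, 37, 40, 42, 41, 29, 35, 36,
    46, 34, 44, 33, 30], [51, 61, 52, 58, 18, 59, 27, 21, 1, 56, 62, 55, 50, 25, 54, 5, 17, 45,
    33, 35, 57, 47, 44, 42, 53, 36, 38, 28, 34, 43], [21, 22, 53, 58, 12, 26, 62, 56, 2, 10, 20,
    54, 57, 55, 59, 1, 30, 32, 28, 36, 45, 47, 41, 46, 37, 48, 29, 31, 40], [55, 11, 62, 56, 58,
    7, 50, 9, 54, 53, 60, 5, 57, 13, 4, 41, 52, 51, 44, 43, 35, 38, 47, 39, 31, 45, 32, 37], [23,
    11, 62, 61, 5, 14, 15, 20, 10, 4, 60, 59, 50, 19, 48, 57, 32, 58, 29, 34, 31, 51, 53, 47, 46,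
    39, 38], [54, 60, 56, 4, 3, 12, 18, 21, 61, 52, 62, 6, 16, 28, 55, 46, 33, 37, 51, 39, 31, 32,
    29, 38, 45, 47], [24, 12, 60, 22, 14, 26, 52, 57, 16, 56, 25, 8, 55, 31, 44, 28, 36, 50, 47,
    45, 33, 30, 40, 29, 34], [55, 3, 27, 51, 61, 54, 9, 2, 50, 23, 57, 47, 42, 53, 52, 44, 39, 34,
    49, 28, 32, 36, 43, 35], [51, 60, 52, 15, 4, 10, 62, 25, 54, 59, 31, 40, 42, 29, 48, 38, 36,
    28, 34, 49, 41, 35, 46], [16, 59, 58, 6, 55, 61, 22, 19, 12, 57, 39, 31, 54, 53, 45, 30, 50,
    43, 42, 37, 46, 33], [58, 52, 57, 13, 55, 61, 53, 62, 34, 29, 43, 48, 31, 46, 33, 44, 42, 28,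
    39, 47, 49], [50, 61, 62, 24, 0, 57, 55, 43, 38, 39, 31, 28, 49, 32, 48, 41, 40, 30, 44, 45],
    [59, 19, 51, 21, 60, 56, 42, 46, 41, 30, 34, 57, 49, 55, 40, 44, 48, 38, 32], [58, 50, 13, 22,
    2, 46, 56, 37, 34, 38, 32, 51, 41, 45, 43, 31, 42, 29], [59, 7, 52, 53, 32, 30, 48, 49, 33,
    40, 28, 37, 44, 46, 34, 36, 42], [53, 8, 0, 44, 43, 36, 47, 30, 41, 29, 33, 31, 45, 35, 40,
    39], [24, 60, 38, 28, 58, 46, 32, 33, 37, 34, 52, 35, 49, 41, 36], [51, 35, 49, 45, 41, 39,
    56, 55, 42, 29, 33, 43, 30, 28], [29, 48, 30, 45, 58, 42, 43, 38, 54, 39, 47, 28, 41], [61,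
    62, 60, 59, 37, 3, 40, 1, 54, 53, 51, 52], [34, 59, 62, 36, 44, 35, 60, 53, 58, 50, 54], [38,
    61, 59, 60, 29, 47, 55, 56, 54, 50], [40, 61, 62, 32, 35, 51, 50, 55, 56], [15, 7, 60, 49, 50,
    57, 52, 51], [48, 43, 17, 52, 62, 53, 60], [59, 61, 57, 52, 58, 53], [30, 56, 54, 62, 61],
    [62, 51, 56, 59], [26, 17, 58], [24, 55], [57], []]"]) code_simp

section \<open>Explicit edge colourings for orders 1 (mod 4)\<close>

lemma extendable_13: "extendable 13"
  \<comment> \<open>The new points split as 6 + 4 + 4. With the old classes this gives sizes 12, 9,
    6, and 66 + 36 + 15 = 117 is the number of triples at order 27.\<close>
  by (rule extendable_table[OF bicoloured_sts_13, where ds = "[6, 10]" and U = "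
    [[8, 10, 12, 7, 9, 1, 2, 6, 3, 0, 11, 4, 5], [7, 11, 9, 6, 2, 0, 3, 10, 1, 4, 5, 12], [6, 8,
    11, 9, 4, 2, 0, 3, 5, 12, 1], [10, 8, 5, 3, 9, 7, 2, 0, 1, 4], [12, 3, 6, 4, 2, 5, 1, 0, 11],
    [10, 5, 7, 1, 4, 2, 3, 0], [12, 0, 4, 11, 6, 7, 8], [1, 11, 10, 9, 8, 7], [5, 12, 8, 11, 10],
    [8, 12, 6, 9], [7, 9, 6], [10, 3], [2], []]"]) code_simp

lemma extendable_21: "extendable 21"
  by (rule extendable_table[OF bicoloured_sts_21, where ds = "[7, 17]" and U = "
    [[15, 19, 16, 14, 18, 20, 3, 4, 12, 5, 10, 7, 8, 2, 13, 11, 6, 17, 1, 9, 0], [17, 10, 18, 20,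
    16, 12, 3, 13, 0, 9, 4, 11, 14, 7, 2, 19, 5, 8, 1, 6], [11, 20, 16, 18, 13, 1, 8, 12, 15, 14,
    10, 9, 4, 7, 2, 6, 5, 0, 3], [17, 19, 13, 14, 2, 15, 6, 7, 1, 4, 0, 12, 3, 9, 8, 18, 20, 5],
    [12, 19, 15, 8, 7, 4, 13, 10, 9, 5, 11, 6, 1, 3, 0, 2, 16], [17, 8, 0, 10, 14, 1, 11, 13, 7,
    2, 15, 3, 4, 6, 5, 9], [11, 14, 4, 9, 0, 3, 12, 15, 1, 10, 5, 2, 7, 6, 8], [6, 5, 7, 2, 9, 0,
    4, 19, 1, 18, 20, 10, 16, 17], [20, 17, 16, 18, 7, 19, 5, 9, 10, 11, 13, 12, 15], [2, 6, 17,
    1, 3, 9, 0, 14, 16, 19, 18, 11], [19, 20, 3, 1, 8, 18, 11, 13, 16, 15, 10], [8, 5, 20, 3, 4,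
    17, 18, 11, 14, 12], [2, 6, 0, 5, 16, 12, 15, 13, 19], [18, 6, 16, 15, 19, 20, 17, 14], [16,
    8, 12, 10, 17, 11, 13], [17, 20, 15, 14, 10, 18], [13, 14, 12, 19, 20], [0, 4, 8, 7], [9, 7,
    1], [3, 2], [4], []]"]) code_simp

lemma extendable_45: "extendable 45"
  \<comment> \<open>The new points split as 22 + 12 + 8 + 4, which gives classes of 44, 25, 14 and 8
    points with 946 + 300 + 91 + 28 = 1365 monochromatic pairs, the number of triples at order
    91.\<close>
  by (rule extendable_table[OF bicoloured_sts_45, where ds = "[22, 34, 42]" and U = "
    [[44, 42, 34, 37, 36, 26, 33, 41, 31, 35, 43, 22, 40, 24, 23, 25, 28, 32, 30, 38, 39, 29, 19,
    2, 11, 14, 16, 6, 27, 17, 0, 1, 13, 15, 12, 5, 7, 21, 20, 4, 9, 10, 3, 18, 8], [36, 37, 31,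
    26, 41, 29, 30, 38, 22, 33, 35, 39, 28, 42, 32, 43, 24, 23, 27, 34, 10, 15, 1, 14, 9, 0, 20,
    12, 3, 25, 19, 16, 5, 18, 17, 21, 40, 11, 2, 6, 4, 13, 8, 7], [35, 23, 44, 25, 43, 38, 39, 26,
    31, 27, 37, 33, 24, 34, 40, 30, 29, 22, 41, 19, 13, 32, 15, 0, 20, 10, 17, 28, 16, 7, 5, 11,
    21, 3, 4, 18, 8, 9, 14, 1, 6, 2, 12], [42, 27, 44, 38, 40, 24, 25, 22, 33, 26, 30, 43, 23, 31,
    36, 41, 32, 28, 17, 29, 0, 16, 5, 7, 21, 18, 15, 8, 3, 19, 14, 11, 20, 13, 12, 4, 39, 1, 6, 2,
    10, 9], [38, 28, 34, 29, 27, 44, 41, 40, 25, 39, 30, 33, 22, 35, 24, 43, 36, 13, 3, 14, 17,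
    21, 2, 32, 4, 7, 10, 20, 26, 18, 6, 15, 5, 0, 9, 12, 19, 11, 8, 16, 1], [22, 23, 42, 29, 39,
    24, 37, 41, 34, 35, 28, 32, 33, 25, 31, 43, 12, 6, 11, 19, 7, 9, 14, 8, 16, 30, 4, 1, 40, 17,
    2, 20, 10, 15, 21, 3, 0, 5, 13, 18], [27, 31, 43, 30, 40, 34, 24, 29, 39, 37, 36, 42, 33, 23,
    35, 1, 32, 5, 8, 17, 4, 12, 19, 9, 13, 16, 11, 21, 2, 0, 38, 14, 6, 7, 18, 3, 10, 20, 15],
    [24, 41, 36, 35, 28, 42, 22, 31, 40, 25, 37, 32, 30, 44, 11, 26, 4, 20, 12, 15, 13, 6, 5, 17,
    10, 0, 39, 14, 8, 3, 9, 21, 16, 7, 19, 18, 1, 2], [37, 23, 26, 44, 32, 35, 33, 43, 39, 34, 36,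
    28, 25, 7, 18, 3, 22, 2, 8, 9, 15, 21, 5, 27, 12, 19, 20, 11, 10, 13, 17, 1, 0, 16, 14, 4, 6],
    [40, 28, 32, 33, 25, 22, 42, 30, 44, 34, 26, 23, 20, 21, 7, 13, 16, 6, 15, 5, 4, 11, 12, 3, 9,
    0, 35, 8, 2, 10, 17, 36, 18, 1, 19, 14], [38, 43, 29, 37, 28, 41, 34, 31, 27, 42, 24, 2, 8, 9,
    6, 18, 1, 7, 33, 14, 20, 17, 32, 3, 10, 13, 12, 11, 16, 5, 4, 21, 0, 15, 19], [30, 23, 32, 25,
    36, 42, 39, 44, 29, 37, 0, 1, 27, 2, 20, 11, 16, 14, 13, 34, 21, 8, 17, 7, 9, 19, 6, 12, 18,
    10, 15, 4, 5, 3], [31, 23, 38, 39, 41, 29, 42, 36, 26, 3, 12, 25, 18, 8, 24, 19, 13, 10, 4, 6,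
    15, 1, 5, 21, 11, 16, 2, 20, 17, 14, 9, 7, 0], [36, 34, 38, 44, 43, 28, 35, 30, 9, 5, 18, 1,
    3, 10, 22, 11, 8, 14, 2, 27, 13, 15, 12, 17, 4, 19, 0, 20, 7, 21, 6, 16], [40, 44, 38, 26, 43,
    41, 42, 31, 7, 21, 27, 4, 14, 3, 16, 19, 2, 18, 6, 12, 1, 10, 9, 15, 0, 8, 13, 5, 17, 11, 20],
    [26, 29, 41, 37, 44, 32, 16, 2, 6, 10, 27, 12, 5, 0, 18, 1, 11, 20, 7, 9, 4, 15, 17, 3, 36,
    21, 8, 19, 14, 13], [35, 27, 31, 24, 29, 8, 0, 19, 4, 10, 3, 17, 22, 6, 18, 30, 21, 2, 13, 7,
    1, 20, 14, 15, 16, 12, 11, 9, 5], [23, 26, 37, 27, 6, 10, 13, 33, 24, 5, 1, 9, 11, 19, 15, 17,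
    8, 4, 18, 2, 3, 7, 14, 12, 20, 16, 0, 21], [38, 40, 22, 14, 4, 8, 5, 25, 13, 2, 21, 0, 6, 28,
    10, 20, 19, 16, 18, 7, 1, 3, 15, 9, 12, 17, 11], [39, 40, 15, 17, 16, 12, 11, 21, 4, 1, 22, 7,
    14, 9, 0, 8, 6, 35, 5, 18, 19, 2, 13, 20, 3, 10], [33, 34, 14, 10, 9, 6, 25, 0, 7, 20, 12, 8,
    18, 4, 3, 19, 16, 1, 5, 13, 11, 2, 15, 21, 17], [21, 16, 20, 3, 31, 18, 8, 10, 2, 15, 9, 14,
    6, 38, 1, 0, 19, 13, 11, 5, 17, 7, 12, 4], [41, 44, 39, 43, 40, 18, 36, 37, 42, 5, 4, 23, 30,
    27, 24, 33, 38, 35, 28, 25, 22, 32, 26], [42, 35, 44, 38, 11, 20, 36, 9, 37, 40, 31, 24, 30,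
    39, 28, 33, 25, 34, 43, 27, 22, 23], [36, 15, 17, 39, 41, 12, 37, 35, 43, 38, 40, 23, 33, 29,
    22, 28, 31, 24, 34, 26, 30], [37, 42, 43, 44, 41, 21, 0, 7, 24, 23, 34, 31, 26, 25, 40, 38,
    32, 29, 30, 28], [19, 41, 38, 1, 40, 13, 42, 22, 34, 36, 32, 39, 30, 33, 35, 26, 23, 28, 29],
    [35, 39, 43, 41, 44, 36, 26, 29, 33, 23, 27, 37, 32, 22, 30, 28, 34, 31], [40, 42, 36, 38, 44,
    33, 31, 26, 37, 34, 28, 23, 25, 29, 30, 24, 27], [35, 3, 43, 2, 34, 26, 37, 28, 25, 24, 29,
    30, 31, 42, 23, 32], [44, 40, 38, 25, 33, 32, 27, 23, 26, 30, 39, 34, 31, 29, 24], [39, 35,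
    27, 22, 38, 29, 24, 31, 26, 23, 28, 32, 43, 33], [41, 32, 36, 31, 34, 22, 23, 24, 29, 42, 26,
    33, 25], [29, 28, 25, 22, 30, 39, 37, 33, 23, 24, 31, 34], [16, 28, 30, 43, 41, 10, 42, 35,
    36, 44, 37], [43, 25, 41, 44, 27, 32, 39, 37, 35, 42], [14, 42, 29, 22, 24, 44, 41, 39, 40],
    [44, 42, 6, 26, 41, 43, 40, 36], [32, 31, 8, 36, 38, 37, 35], [34, 27, 40, 35, 36, 43], [43,
    38, 44, 42, 41], [37, 40, 41, 44], [33, 27, 22], [25, 39], [38], []]"]) code_simp

lemma extendable_49: "extendable 49"
  by (rule extendable_table[OF bicoloured_sts_49, where ds = "[24, 36, 47]" and U = "
    [[38, 39, 48, 37, 46, 33, 41, 28, 47, 30, 42, 36, 24, 32, 44, 45, 35, 40, 25, 31, 26, 29, 43,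
    16, 5, 21, 27, 9, 4, 2, 15, 34, 8, 0, 1, 17, 23, 7, 18, 20, 19, 13, 10, 6, 22, 12, 3, 14, 11],
    [45, 26, 33, 47, 46, 37, 48, 35, 32, 40, 28, 42, 44, 29, 27, 39, 25, 30, 43, 31, 34, 24, 20,
    23, 17, 2, 19, 6, 8, 36, 3, 12, 7, 4, 5, 21, 10, 1, 41, 9, 18, 22, 16, 15, 14, 11, 0, 13],
    [47, 44, 26, 36, 43, 40, 28, 31, 46, 37, 27, 33, 34, 35, 48, 24, 29, 32, 42, 38, 30, 14, 2, 3,
    23, 20, 25, 0, 13, 7, 6, 22, 15, 19, 1, 4, 5, 18, 10, 8, 12, 41, 11, 9, 21, 17, 16], [31, 39,
    24, 28, 46, 43, 36, 34, 30, 41, 37, 33, 42, 29, 27, 40, 44, 38, 45, 25, 5, 32, 9, 11, 35, 7,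
    13, 12, 6, 14, 8, 3, 20, 0, 1, 16, 2, 4, 10, 18, 15, 17, 22, 23, 21, 19], [48, 34, 30, 39, 24,
    43, 32, 46, 38, 40, 28, 41, 47, 36, 45, 26, 29, 42, 35, 25, 18, 10, 21, 17, 16, 12, 4, 0, 13,
    1, 27, 23, 2, 9, 19, 22, 11, 20, 3, 7, 6, 5, 14, 8, 15], [31, 38, 44, 42, 33, 27, 41, 29, 25,
    35, 37, 45, 30, 24, 28, 43, 40, 32, 11, 13, 34, 9, 16, 18, 22, 19, 17, 0, 36, 21, 6, 14, 3,
    15, 12, 20, 5, 4, 23, 7, 2, 8, 10, 1], [40, 29, 32, 42, 48, 25, 28, 38, 39, 26, 27, 45, 44,
    41, 47, 43, 37, 30, 10, 19, 35, 11, 15, 9, 16, 13, 7, 17, 0, 4, 6, 12, 23, 8, 21, 14, 20, 22,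
    3, 1, 18, 5, 2], [35, 34, 45, 44, 48, 47, 26, 42, 29, 25, 46, 32, 33, 27, 36, 39, 2, 19, 15,
    22, 6, 14, 17, 5, 10, 24, 31, 16, 7, 9, 8, 13, 11, 23, 3, 0, 1, 4, 21, 12, 18, 20], [33, 41,
    37, 34, 45, 47, 25, 31, 24, 32, 43, 27, 36, 30, 38, 6, 26, 1, 5, 7, 20, 21, 18, 4, 11, 15, 2,
    12, 10, 14, 42, 17, 8, 19, 9, 3, 13, 16, 22, 23, 0], [27, 41, 44, 37, 45, 30, 36, 38, 31, 26,
    25, 39, 46, 48, 1, 4, 13, 7, 21, 29, 14, 6, 16, 17, 10, 23, 8, 20, 5, 3, 9, 2, 22, 15, 12, 40,
    11, 0, 19, 18], [25, 35, 46, 34, 48, 39, 28, 37, 47, 38, 24, 44, 26, 21, 12, 23, 18, 14, 2, 6,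
    29, 15, 1, 11, 8, 16, 13, 40, 9, 3, 22, 0, 19, 17, 5, 20, 10, 7, 4], [29, 33, 43, 24, 38, 31,
    26, 28, 45, 35, 47, 36, 17, 8, 2, 14, 30, 12, 20, 1, 18, 10, 3, 19, 9, 15, 0, 22, 21, 6, 16,
    13, 5, 39, 7, 4, 11, 23], [32, 31, 40, 47, 43, 38, 39, 42, 45, 24, 27, 13, 6, 22, 1, 26, 0,
    10, 33, 11, 2, 19, 18, 3, 4, 21, 14, 7, 16, 23, 8, 9, 20, 15, 17, 12, 5], [36, 31, 30, 34, 39,
    48, 40, 25, 35, 44, 18, 7, 11, 6, 1, 3, 23, 10, 8, 26, 5, 13, 2, 17, 19, 12, 15, 14, 43, 16,
    4, 9, 0, 20, 22, 21], [46, 24, 42, 35, 27, 30, 48, 28, 41, 8, 16, 20, 3, 0, 1, 15, 2, 29, 19,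
    13, 14, 39, 18, 23, 21, 10, 17, 4, 5, 11, 12, 6, 7, 9, 22], [32, 41, 47, 38, 36, 37, 27, 45,
    4, 20, 0, 8, 3, 17, 5, 26, 22, 15, 2, 12, 1, 11, 43, 7, 16, 18, 9, 14, 21, 10, 23, 19, 13, 6],
    [40, 43, 46, 48, 44, 33, 34, 23, 9, 6, 28, 12, 5, 11, 21, 2, 25, 18, 7, 14, 8, 22, 0, 19, 3,
    15, 17, 13, 16, 4, 1, 20, 10], [44, 36, 37, 32, 26, 46, 3, 0, 33, 17, 2, 8, 19, 7, 14, 9, 6,
    30, 21, 22, 18, 20, 4, 5, 11, 1, 10, 23, 13, 16, 15, 12], [41, 34, 33, 48, 42, 10, 22, 8, 15,
    29, 13, 7, 9, 28, 23, 20, 11, 18, 3, 16, 4, 6, 12, 2, 21, 0, 19, 17, 5, 1, 14], [35, 34, 37,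
    33, 0, 15, 16, 10, 5, 31, 4, 20, 23, 18, 9, 22, 11, 12, 17, 2, 14, 42, 21, 7, 19, 1, 8, 13, 6,
    3], [46, 39, 47, 9, 1, 12, 16, 4, 10, 24, 23, 5, 20, 21, 29, 22, 19, 15, 17, 0, 13, 6, 11, 14,
    8, 18, 2, 3, 7], [41, 40, 19, 28, 14, 0, 13, 30, 3, 22, 21, 4, 16, 6, 15, 5, 11, 8, 1, 7, 12,
    23, 20, 18, 10, 9, 2, 17], [31, 22, 17, 32, 12, 18, 11, 1, 14, 19, 5, 25, 20, 13, 16, 2, 10,
    23, 0, 7, 6, 8, 21, 3, 15, 4, 9], [12, 3, 4, 13, 28, 22, 29, 0, 1, 21, 23, 9, 10, 7, 20, 11,
    5, 15, 17, 2, 18, 14, 19, 6, 16, 8], [46, 7, 48, 15, 40, 42, 47, 45, 39, 43, 44, 32, 31, 41,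
    26, 29, 33, 36, 34, 38, 24, 35, 37, 27, 28], [44, 40, 48, 21, 47, 11, 43, 45, 14, 38, 25, 35,
    42, 34, 31, 36, 39, 27, 37, 29, 41, 24, 30, 33], [45, 47, 41, 18, 46, 38, 48, 39, 5, 43, 40,
    29, 37, 36, 28, 35, 42, 30, 25, 31, 27, 26, 24], [46, 19, 44, 42, 20, 41, 4, 47, 29, 39, 31,
    25, 26, 30, 24, 38, 36, 43, 34, 33, 37, 32], [23, 45, 8, 42, 22, 44, 10, 27, 25, 39, 33, 38,
    43, 40, 41, 32, 34, 24, 31, 36, 37], [46, 48, 9, 44, 47, 45, 33, 36, 34, 43, 27, 38, 42, 24,
    26, 37, 39, 32, 28, 35], [41, 48, 16, 40, 39, 31, 43, 27, 38, 28, 25, 37, 35, 34, 33, 30, 26,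
    32, 36], [44, 3, 45, 17, 38, 27, 24, 32, 39, 37, 25, 40, 28, 35, 43, 30, 34, 31], [47, 12, 46,
    41, 24, 25, 36, 32, 39, 30, 37, 33, 27, 40, 35, 31, 26], [46, 43, 36, 34, 33, 30, 42, 32, 38,
    28, 40, 31, 37, 29, 35, 27], [48, 37, 42, 32, 41, 35, 27, 34, 26, 24, 38, 29, 28, 33, 30],
    [34, 41, 37, 28, 33, 40, 31, 32, 35, 42, 26, 36, 24, 25], [30, 45, 35, 24, 26, 47, 46, 44, 0,
    28, 48, 42, 40], [26, 29, 37, 46, 28, 44, 45, 32, 33, 38, 48, 47], [6, 13, 35, 44, 30, 48, 28,
    36, 47, 46, 38], [45, 24, 27, 31, 46, 47, 48, 40, 44, 39], [34, 46, 48, 25, 30, 47, 44, 40,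
    43], [1, 29, 31, 48, 45, 41, 47, 44], [33, 29, 26, 32, 45, 41, 48], [47, 36, 25, 39, 43, 45],
    [2, 27, 43, 39, 42], [44, 46, 45, 41], [42, 38, 46], [25, 34], [29], []]"]) code_simp

section \<open>Pairs of classes covering half the points\<close>

lemma halved_9: "halved 9"
  \<comment> \<open>The classes numbered 0 and 2 have 4 + 1 = 5 points. The choices for the other
    orders are read off from the interval ends in the same way.\<close>
  by (rule halvedI[OF bicoloured_sts_9, of 0 2]) code_simp

lemma halved_13: "halved 13"
  by (rule halvedI[OF bicoloured_sts_13, of 1 2]) code_simp

lemma halved_21: "halved 21"
  by (rule halvedI[OF bicoloured_sts_21, of 1 2]) code_simp

lemma halved_25: "halved 25"
  by (rule halvedI[OF bicoloured_sts_25, of 0 3]) code_simp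

lemma halved_33: "halved 33"
  by (rule halvedI[OF bicoloured_sts_33, of 0 3]) code_simp

lemma halved_37: "halved 37"
  by (rule halvedI[OF bicoloured_sts_37, of 1 2]) code_simp

lemma halved_63: "halved 63"
  by (rule halvedI[OF bicoloured_sts_63, of 0 3]) code_simp

theorem theorem10:
  fixes w :: nat
  assumes "w \<in> {27, 39, 43, 55, 79, 87, 91, 99, 103, 111, 127, 135, 151, 159, 175}"
  shows "(\<exists>(V :: nat set) B Y B' k (C :: nat \<Rightarrow> nat) C'.
            steiner_triple_system ((w - 1) div 2) V B \<and>
            doubling_construction V B Y B' \<and>
            steiner_triple_system w (V \<union> Y) B' \<and>
            extended_bicoloring k V B C Y B' C') \<and>
         (\<exists>(V :: nat set) B.
            steiner_triple_system w V B \<and>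
            bicolorable V B \<and>
            lower_chromatic_number V B \<noteq> upper_chromatic_number V B)"
proof -
  \<comment> \<open>The seeds 9, 13, 21, 25, 33 and 37 are all 1 (mod 4); their doubles are 3 (mod
    4).\<close>
  have "halved 19" "halved 27" "halved 43" "halved 51" "halved 67" "halved 75"
    using halved_double[OF halved_9] halved_double[OF halved_13] halved_double[OF halved_21]
      halved_double[OF halved_25] halved_double[OF halved_33] halved_double[OF halved_37]
    by simp_all
  moreover have "halved 39" "halved 55" "halved 87"
    using calculation(1-3)[THEN halved_double] by simp_all
  moreover have "halved 79"
    using halved_double[OF \<open>halved 39\<close>] by simp
  ultimately have "\<forall>v\<in>{19, 27, 39, 43, 51, 55, 63, 67, 75, 79, 87}. extendable v"
    using halved_63 by (simp add: halved_extendable)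
  \<comment> \<open>The orders added here, 13, 21, 45 and 49, are those congruent to 1 (mod
    4).\<close>
  then have "\<forall>v\<in>{13, 19, 21, 27, 39, 43, 45, 49, 51, 55, 63, 67, 75, 79, 87}. extendable v"
    using extendable_13 extendable_21 extendable_45 extendable_49 by simp
  moreover have "(w - 1) div 2 \<in> {13, 19, 21, 27, 39, 43, 45, 49, 51, 55, 63, 67, 75, 79, 87}"
    and "w = 2 * ((w - 1) div 2) + 1"
    using assms by auto
  ultimately show ?thesis
    by (intro extendable_doubling[of "(w - 1) div 2"]) blast+
qed

end
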